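(* Let $\Omega\subset\mathbb{R}^n$ be a bounded domain with $C^2$ boundary, $0<s_2<s_1<1$, $n>2s_1$, $0<\mu<n$, $1<q<p<2$, $1<r\le 2^*_\mu$, $\lambda,\beta>0$, and let $a\in L^{\frac{d}{d-q}}(\Omega)$, for some $q<d<2^*_{s_1}$, be a sign-changing function with $a^+:=\max\{a,0\}\not\equiv 0$. Suppose $\mu<4s_1$ and that $a$ is bounded in $\Omega$. If $u$ is a non-negative solution of problem $(P_\lambda)$, then $u\in L^\infty(\Omega)$.
   Context: $2^*_{s_1}=\frac{2n}{n-2s_1}$, $2^*_\mu=\frac{2n-\mu}{n-2s_1}$. Problem $(P_\lambda)$ is $$(-\Delta)^{s_1}u+\beta(-\Delta)^{s_2}_pu=\lambda a(x)|u|^{q-2}u+\Big(\int_\Omega\frac{|u(y)|^r}{|x-y|^\mu}\,dy\Big)|u|^{r-2}u\ \text{ in }\Omega,\qquad u=0\ \text{ in }\mathbb{R}^n\setminus\Omega,$$ understood in the following weak sense. Let $Q=\mathbb{R}^{2n}\setminus(\Omega^c\times\Omega^c)$, $p_1=2$, $p_2=p$, and for $i=1,2$ let $X_i$ be the space of $u\in L^{p_i}(\mathbb{R}^n)$ with $u=0$ a.e. in $\mathbb{R}^n\setminus\Omega$ and $\|u\|_{X_i}:=\big(\int_Q\frac{|u(x)-u(y)|^{p_i}}{|x-y|^{n+p_is_i}}\,dxdy\big)^{1/p_i}<\infty$ (one has $X_1\subset X_2$ continuously). Put $$\mathcal{K}_i(u,v)=\int_Q\frac{|u(x)-u(y)|^{p_i-2}(u(x)-u(y))(v(x)-v(y))}{|x-y|^{n+p_is_i}}\,dxdy,\qquad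 \mathcal{A}_r(u,v)=\int_\Omega\int_\Omega\frac{|u(y)|^r|u(x)|^{r-2}u(x)v(x)}{|x-y|^\mu}\,dxdy.$$ A solution of $(P_\lambda)$ is a function $u\in X_1$ such that $\mathcal{K}_1(u,v)+\beta\mathcal{K}_2(u,v)-\lambda\int_\Omega a(x)|u|^{q-2}uv\,dx-\mathcal{A}_r(u,v)=0$ for all $v\in X_1$. *)

theory Defs
  imports "HOL-Analysis.Analysis"
begin

definition C2 :: "('a::euclidean_space \<Rightarrow> real) \<Rightarrow> bool" where
  "C2 f \<longleftrightarrow>
    (\<exists>(f' :: 'a \<Rightarrow> 'a \<Rightarrow>\<^sub>L real) (f'' :: 'a \<Rightarrow> 'a \<Rightarrow>\<^sub>L 'a \<Rightarrow>\<^sub>L real).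
      (\<forall>x. (f has_derivative blinfun_apply (f' x)) (at x)) \<and>
      (\<forall>x. (f' has_derivative blinfun_apply (f'' x)) (at x)) \<and>
      continuous_on UNIV f'')"

text \<open>Locally, up to a rigid motion, the set lies on one side of the graph of a \<open>C\<^sup>2\<close>
  function of \<open>n - 1\<close> variables. The unit vector \<open>e\<close> is the graph direction, and \<open>g\<close> is only
  evaluated on the hyperplane orthogonal to \<open>e\<close>; a \<open>C\<^sup>2\<close> function on that hyperplane extends to
  the whole space by composition with the orthogonal projection.\<close>

definition C2_boundary :: "'a::euclidean_space set \<Rightarrow> bool" where
  "C2_boundary \<Omega> \<longleftrightarrow>
    (\<forall>x0 \<in> frontier \<Omega>. \<exists>\<rho>>0. \<exists>e g. norm e = 1 \<and> C2 g \<and>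
      \<Omega> \<inter> ball x0 \<rho> = {x \<in> ball x0 \<rho>. g (x - (x \<bullet> e) *\<^sub>R e) < x \<bullet> e})"

definition Lp :: "'a measure \<Rightarrow> real \<Rightarrow> ('a \<Rightarrow> real) set" where
  "Lp M p = {f \<in> borel_measurable M. integrable M (\<lambda>x. \<bar>f x\<bar> powr p)}"

definition Linf :: "'a measure \<Rightarrow> ('a \<Rightarrow> real) set" where
  "Linf M = {f \<in> borel_measurable M. \<exists>C. AE x in M. \<bar>f x\<bar> \<le> C}"

definition sign_changing :: "'a measure \<Rightarrow> ('a \<Rightarrow> real) \<Rightarrow> bool" where
  "sign_changing M f \<longleftrightarrow> \<not> (AE x in M. 0 \<le> f x) \<and> \<not> (AE x in M. f x \<le> 0)"

definition sobolev_exponent :: "real \<Rightarrow> real \<Rightarrow> real" where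
  "sobolev_exponent n s = 2 * n / (n - 2 * s)"

definition choquard_exponent :: "real \<Rightarrow> real \<Rightarrow> real \<Rightarrow> real" where
  "choquard_exponent n s \<mu> = (2 * n - \<mu>) / (n - 2 * s)"

text \<open>The expression \<open>|t|\<^sup>p\<^sup>-\<^sup>2 t\<close>; its value at \<open>0\<close> is \<open>0\<close>, also when \<open>p < 2\<close>.\<close>

definition signed_pow :: "real \<Rightarrow> real \<Rightarrow> real" where
  "signed_pow p t = \<bar>t\<bar> powr (p - 2) * t"

definition cross_region :: "'a set \<Rightarrow> ('a \<times> 'a) set" where
  "cross_region \<Omega> = - ((- \<Omega>) \<times> (- \<Omega>))"

text \<open>In the double integrals the diagonal, where the kernels take the value \<open>0\<close> by the
  convention \<open>c / 0 = 0\<close>, is a null set.\<close>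

definition frac_space :: "'a::euclidean_space set \<Rightarrow> real \<Rightarrow> real \<Rightarrow> ('a \<Rightarrow> real) set" where
  "frac_space \<Omega> s p = {u \<in> Lp lebesgue p. (AE x in lebesgue. x \<notin> \<Omega> \<longrightarrow> u x = 0) \<and>
     set_integrable (lebesgue \<Otimes>\<^sub>M lebesgue) (cross_region \<Omega>)
       (\<lambda>(x, y). \<bar>u x - u y\<bar> powr p / norm (x - y) powr (real DIM('a) + p * s))}"

definition frac_form :: "'a::euclidean_space set \<Rightarrow> real \<Rightarrow> real \<Rightarrow> ('a \<Rightarrow> real) \<Rightarrow> ('a \<Rightarrow> real) \<Rightarrow> real" where
  "frac_form \<Omega> s p u v = set_lebesgue_integral (lebesgue \<Otimes>\<^sub>M lebesgue) (cross_region \<Omega>)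
     (\<lambda>(x, y). signed_pow p (u x - u y) * (v x - v y) / norm (x - y) powr (real DIM('a) + p * s))"

definition choquard_form :: "'a::euclidean_space set \<Rightarrow> real \<Rightarrow> real \<Rightarrow> ('a \<Rightarrow> real) \<Rightarrow> ('a \<Rightarrow> real) \<Rightarrow> real" where
  "choquard_form \<Omega> \<mu> r u v = set_lebesgue_integral (lebesgue \<Otimes>\<^sub>M lebesgue) (\<Omega> \<times> \<Omega>)
     (\<lambda>(x, y). \<bar>u y\<bar> powr r * signed_pow r (u x) * v x / norm (x - y) powr \<mu>)"

text \<open>Weak solutions of
  \<open>(-\<Delta>)\<^sup>s\<^sup>1 u + \<beta> (-\<Delta>)\<^sub>p\<^sup>s\<^sup>2 u = \<lambda> a |u|\<^sup>q\<^sup>-\<^sup>2 u + (\<integral>\<^sub>\<Omega> |u(y)|\<^sup>r / |x - y|\<^sup>\<mu> dy) |u|\<^sup>r\<^sup>-\<^sup>2 u\<close> in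
  \<open>\<Omega>\<close>, with \<open>u = 0\<close> outside \<open>\<Omega>\<close>.\<close>

definition is_solution ::
  "'a::euclidean_space set \<Rightarrow> real \<Rightarrow> real \<Rightarrow> real \<Rightarrow> real \<Rightarrow> real \<Rightarrow> real \<Rightarrow> ('a \<Rightarrow> real) \<Rightarrow>
    real \<Rightarrow> real \<Rightarrow> ('a \<Rightarrow> real) \<Rightarrow> bool" where
  "is_solution \<Omega> s1 s2 p q r \<mu> a \<beta> lam u \<longleftrightarrow>
    u \<in> frac_space \<Omega> s1 2 \<and>
    (\<forall>v \<in> frac_space \<Omega> s1 2.
      frac_form \<Omega> s1 2 u v + \<beta> * frac_form \<Omega> s2 p u v
      - lam * set_lebesgue_integral lebesgue \<Omega> (\<lambda>x. a x * signed_pow q (u x) * v x)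
      - choquard_form \<Omega> \<mu> r u v = 0)"

end

theory Submission
  imports Defs
begin

text \<open>Testing the equation with \<open>\<phi> \<circ> u\<close>, \<open>\<phi>\<close> nondecreasing, Lipschitz and zero on the negative
  axis, makes the \<open>p\<close>-term nonnegative, so it can be dropped; the fractional Sobolev inequality then
  bounds a power of \<open>u\<close> in \<open>L\<^sup>P\<close> by the reaction terms. Truncated powers of \<open>u\<close>, combined with the
  Hardy--Littlewood--Sobolev inequality and the smallness of \<open>u\<close> in \<open>L\<^sup>P\<close> over \<open>{u > k}\<close>
  (Brezis and Kato), give \<open>u \<in> L\<^sup>m\<close> for every finite \<open>m\<close>. Hence the Riesz potential of
  \<open>1 + u\<^sup>R\<close> is bounded on \<open>\<Omega>\<close>, and De Giorgi's level-set iteration on \<open>(u - k)\<^sup>+\<close> gives \<open>u \<in> L\<^sup>\<infinity>\<close>.\<close>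

section \<open>Riesz kernels and Hoelder's inequality\<close>

text \<open>The obstacle is that \<open>r\<close> may equal the critical exponent \<open>R\<close>.
  Initially only \<open>u\<close> in \<open>L^P\<close> is available, and the
  Hardy-Littlewood-Sobolev pairing then yields an estimate with the same power of the truncated norm
  on both sides. Homogeneity alone gains nothing; a small coefficient must do the work. It comes
  from the factor \<open>u^(R - 2)\<close> on \<open>{u > k}\<close>, which carries a positive
  Hoelder exponent exactly because \<open>R > 2\<close>.

  All reaction terms are reduced to one. The function \<open>1 + u^R\<close> dominates
  \<open>u^r\<close>, and its Riesz potential is bounded below by a positive constant on \<Omega>,
  so the term with the bounded coefficient \<open>a\<close> is absorbed into the nonlocal one. Every
  estimate then involves a single integral of the potential against a weight. The level-set
  iteration is run only once the potential is known to be bounded, so that the remaining reaction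
  depends on \<open>u\<close> alone.

  Integrals are kept in \<open>ennreal\<close>, where an infinite potential is harmless; finiteness
  is established just before a quantity has to be absorbed or divided out.\<close>

lemma sigma_finite_lebesgue: "sigma_finite_measure (lebesgue :: 'a::euclidean_space measure)"
proof -
  obtain A :: "'a set set" where A: "countable A" "A \<subseteq> sets lborel" "\<Union>A = space lborel"
      "\<forall>a\<in>A. emeasure lborel a \<noteq> \<infinity>"
    using lborel.sigma_finite_countable by blast
  show ?thesis
    by (rule sigma_finite_measure.intro) (use A in \<open>auto intro!: exI[of _ A]\<close>)
qed

interpretation lebesgue: sigma_finite_measure "lebesgue :: 'a::euclidean_space measure"
  by (rule sigma_finite_lebesgue)

interpretation lebesgue_pair: pair_sigma_finite
  "lebesgue :: 'a::euclidean_space measure" "lebesgue :: 'b::euclidean_space measure"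
  by (intro pair_sigma_finite.intro sigma_finite_lebesgue)

lemma emeasure_lebesgue_cball:
  assumes "0 \<le> r"
  shows "emeasure lebesgue (cball (x::'a::euclidean_space) r)
    = ennreal (unit_ball_vol DIM('a) * r ^ DIM('a))"
  using emeasure_cball[OF assms, of x] by simp

lemma emeasure_lebesgue_ball:
  assumes "0 \<le> r"
  shows "emeasure lebesgue (ball (x::'a::euclidean_space) r)
    = ennreal (unit_ball_vol DIM('a) * r ^ DIM('a))"
  using emeasure_ball[OF assms, of x] by simp

lemma borel_measurable_kernel [measurable]:
  "(\<lambda>y. norm (x - y) powr m) \<in> borel_measurable (lebesgue :: 'a::euclidean_space measure)"
  by (rule measurable_completion) simp

lemma sets_lebesgue_balls [measurable]:
  "ball (x::'a::euclidean_space) r \<in> sets lebesgue" "cball x r \<in> sets lebesgue"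
  by simp_all

text \<open>A step function on balls majorizes the kernel, so the two radial integrals below become
  geometric series. The centre needs no covering ball, because \<open>0 powr m\<close> is
  \<open>0\<close>.\<close>

lemma nn_integral_le_suminf_cball:
  fixes x :: "'a::euclidean_space"
  assumes "\<And>j. 0 \<le> b j" "\<And>j. 0 \<le> r j"
    and le: "\<And>y. y \<in> A \<Longrightarrow> y \<noteq> x \<Longrightarrow> \<exists>j::nat. y \<in> cball x (r j) \<and> norm (x - y) powr m \<le> b j"
    and sums: "(\<lambda>j. b j * (unit_ball_vol DIM('a) * r j ^ DIM('a))) sums S"
  shows "(\<integral>\<^sup>+y. ennreal (norm (x - y) powr m) * indicator A y \<partial>lebesgue) \<le> ennreal S"
proof -
  have "(\<integral>\<^sup>+y. ennreal (norm (x - y) powr m) * indicator A y \<partial>lebesgue)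
      \<le> (\<integral>\<^sup>+y. (\<Sum>j. ennreal (b j) * indicator (cball x (r j)) y) \<partial>lebesgue)"
  proof (rule nn_integral_mono)
    fix y
    show "ennreal (norm (x - y) powr m) * indicator A y
        \<le> (\<Sum>j. ennreal (b j) * indicator (cball x (r j)) y)"
    proof (cases "y \<in> A \<and> y \<noteq> x")
      case True
      then obtain j where j: "y \<in> cball x (r j)" "norm (x - y) powr m \<le> b j" using le by blast
      have "ennreal (norm (x - y) powr m) * indicator A y \<le> ennreal (b j) * indicator (cball x (r j)) y"
        using j True by (simp add: ennreal_leI)
      also have "\<dots> \<le> (\<Sum>j. ennreal (b j) * indicator (cball x (r j)) y)"
        using sum_le_suminf[of "\<lambda>j. ennreal (b j) * indicator (cball x (r j)) y" "{j}"]
        by (simp del: sum_mult_indicator)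
      finally show ?thesis .
    qed auto
  qed
  also have "\<dots> = (\<Sum>j. \<integral>\<^sup>+y. ennreal (b j) * indicator (cball x (r j)) y \<partial>lebesgue)"
    by (intro nn_integral_suminf borel_measurable_times_ennreal borel_measurable_indicator) auto
  also have "\<dots> = (\<Sum>j. ennreal (b j * (unit_ball_vol DIM('a) * r j ^ DIM('a))))"
    using assms(1,2) emeasure_lebesgue_cball[OF assms(2), where x = x]
    by (simp add: nn_integral_cmult ennreal_mult)
  also have "\<dots> = ennreal S"
    using assms(1,2) by (intro suminf_ennreal_eq[OF _ sums]) simp
  finally show ?thesis .
qed

text \<open>Dyadic shells shrinking towards \<open>x\<close> contribute a geometric series with
  ratio \<open>2 powr (m - n)\<close>, below 1 because the singularity is weaker than the dimension.
  The constant does not depend on the centre or the radius, which later allows a radius chosen from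
  the value of a function at \<open>x\<close>.\<close>

lemma nn_integral_kernel_ball:
  assumes m: "m < real DIM('a::euclidean_space)" "0 \<le> m"
  shows "\<exists>C\<ge>0. \<forall>(x::'a) \<rho>. \<rho> > 0 \<longrightarrow>
    (\<integral>\<^sup>+y. ennreal (norm (x - y) powr - m) * indicator (ball x \<rho>) y \<partial>lebesgue)
      \<le> ennreal (C * \<rho> powr (real DIM('a) - m))"
proof -
  define n where "n = real DIM('a)"
  define q where "q = 2 powr (m - n)"
  have q: "0 \<le> q" "q < 1" using m by (auto simp: q_def n_def powr_less_one)
  define V where "V = unit_ball_vol DIM('a)"
  define C where "C = V * 2 powr m * (1 / (1 - q))"
  have V: "V \<ge> 0" by (simp add: V_def)
  show ?thesis
  proof (intro exI[of _ C] conjI allI impI)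
    show "C \<ge> 0" using V q by (simp add: C_def)
    fix x :: 'a and \<rho> :: real assume \<rho>: "\<rho> > 0"
    \<comment> \<open>Shell \<open>j\<close> lies between the radii \<open>r j / 2\<close> and
      \<open>r j\<close>: its volume is bounded by that of the outer ball, the kernel by its value
      \<open>b j\<close> at the inner radius.\<close>
    define r where "r = (\<lambda>j::nat. \<rho> * 2 powr - real j)"
    define b where "b = (\<lambda>j::nat. (\<rho> * 2 powr (- real j - 1)) powr - m)"
    have trm: "b j * (V * r j ^ DIM('a)) = V * 2 powr m * \<rho> powr (n - m) * q ^ j" for j
    proof -
      have "r j ^ DIM('a) = \<rho> powr n * 2 powr (- real j * n)"
        using \<rho> by (simp add: r_def n_def powr_mult powr_powr flip: powr_realpow)
      moreover have "b j = \<rho> powr - m * 2 powr ((real j + 1) * m)"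
        using \<rho> by (simp add: b_def powr_mult powr_powr algebra_simps)
      moreover have "q ^ j = 2 powr ((m - n) * real j)"
        by (simp add: q_def powr_powr flip: powr_realpow)
      ultimately show ?thesis
        by (simp add: mult_ac flip: powr_add) (simp add: mult.left_commute[of _ "\<rho> powr _"] flip: powr_add mult.assoc, simp add: algebra_simps)
    qed
    have "(\<integral>\<^sup>+y. ennreal (norm (x - y) powr - m) * indicator (ball x \<rho>) y \<partial>lebesgue)
        \<le> ennreal (V * 2 powr m * \<rho> powr (n - m) * (1 / (1 - q)))"
    proof (rule nn_integral_le_suminf_cball[of b r])
      show "b j \<ge> 0" "r j \<ge> 0" for j using \<rho> by (auto simp: b_def r_def)
      show "(\<lambda>j. b j * (unit_ball_vol (real DIM('a)) * r j ^ DIM('a))) sums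
          (V * 2 powr m * \<rho> powr (n - m) * (1 / (1 - q)))"
        unfolding V_def[symmetric] trm using q by (intro sums_mult geometric_sums) auto
      fix y assume y: "y \<in> ball x \<rho>" "y \<noteq> x"
      define z where "z = norm (x - y)"
      have z: "0 < z" "z < \<rho>" using y by (auto simp: z_def dist_norm)
      define j where "j = nat \<lfloor>log 2 (\<rho> / z)\<rfloor>"
      have "0 \<le> log 2 (\<rho> / z)" using z by simp
      then have "real j \<le> log 2 (\<rho> / z)" "log 2 (\<rho> / z) < real j + 1"
        unfolding j_def by linarith+
      then have "2 powr real j \<le> \<rho> / z" "\<rho> / z < 2 powr (real j + 1)"
        using z \<rho> by (auto simp: le_log_iff log_less_iff)
      then have "z \<le> r j" "\<rho> * 2 powr (- real j - 1) \<le> z"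
        using z \<rho> by (auto simp: r_def powr_minus powr_diff powr_add field_simps)
      then show "\<exists>j. y \<in> cball x (r j) \<and> norm (x - y) powr - m \<le> b j"
        using m z powr_mono2'[of "- m" "\<rho> * 2 powr (- real j - 1)" z] \<rho>
        by (intro exI[of _ j]) (auto simp: b_def z_def dist_norm)
    qed
    then show "(\<integral>\<^sup>+y. ennreal (norm (x - y) powr - m) * indicator (ball x \<rho>) y \<partial>lebesgue)
        \<le> ennreal (C * \<rho> powr (real DIM('a) - m))"
      by (simp add: C_def n_def mult_ac)
  qed
qed

text \<open>The same decomposition with shells growing outwards; the ratio is now
  \<open>2 powr (n - m)\<close>, so decay faster than the dimension is what makes the series
  converge.\<close>

lemma nn_integral_kernel_outside_ball:
  assumes m: "real DIM('a::euclidean_space) < m"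
  shows "\<exists>C\<ge>0. \<forall>(x::'a) \<rho>. \<rho> > 0 \<longrightarrow>
    (\<integral>\<^sup>+y. ennreal (norm (x - y) powr - m) * indicator (- ball x \<rho>) y \<partial>lebesgue)
      \<le> ennreal (C * \<rho> powr (real DIM('a) - m))"
proof -
  define n where "n = real DIM('a)"
  define q where "q = 2 powr (n - m)"
  have q: "0 \<le> q" "q < 1" using m by (auto simp: q_def n_def powr_less_one)
  define V where "V = unit_ball_vol DIM('a)"
  define C where "C = V * 2 powr n * (1 / (1 - q))"
  have V: "V \<ge> 0" by (simp add: V_def)
  show ?thesis
  proof (intro exI[of _ C] conjI allI impI)
    show "C \<ge> 0" using V q by (simp add: C_def)
    fix x :: 'a and \<rho> :: real assume \<rho>: "\<rho> > 0"
    define r where "r = (\<lambda>j::nat. \<rho> * 2 powr (real j + 1))"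
    define b where "b = (\<lambda>j::nat. (\<rho> * 2 powr real j) powr - m)"
    have trm: "b j * (V * r j ^ DIM('a)) = V * 2 powr n * \<rho> powr (n - m) * q ^ j" for j
    proof -
      have "r j ^ DIM('a) = \<rho> powr n * 2 powr ((real j + 1) * n)"
        using \<rho> by (simp add: r_def n_def powr_mult powr_powr flip: powr_realpow)
      moreover have "b j = \<rho> powr - m * 2 powr (- real j * m)"
        using \<rho> by (simp add: b_def powr_mult powr_powr algebra_simps)
      moreover have "q ^ j = 2 powr ((n - m) * real j)"
        by (simp add: q_def powr_powr flip: powr_realpow)
      ultimately show ?thesis
        by (simp add: mult_ac flip: powr_add) (simp add: mult.left_commute[of _ "\<rho> powr _"] flip: powr_add mult.assoc, simp add: algebra_simps)
    qed
    have "(\<integral>\<^sup>+y. ennreal (norm (x - y) powr - m) * indicator (- ball x \<rho>) y \<partial>lebesgue)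
        \<le> ennreal (V * 2 powr n * \<rho> powr (n - m) * (1 / (1 - q)))"
    proof (rule nn_integral_le_suminf_cball[of b r])
      show "b j \<ge> 0" "r j \<ge> 0" for j using \<rho> by (auto simp: b_def r_def)
      show "(\<lambda>j. b j * (unit_ball_vol (real DIM('a)) * r j ^ DIM('a))) sums
          (V * 2 powr n * \<rho> powr (n - m) * (1 / (1 - q)))"
        unfolding V_def[symmetric] trm using q by (intro sums_mult geometric_sums) auto
      fix y assume y: "y \<in> - ball x \<rho>" "y \<noteq> x"
      define z where "z = norm (x - y)"
      have z: "0 < z" "\<rho> \<le> z" using y by (auto simp: z_def dist_norm)
      define j where "j = nat \<lfloor>log 2 (z / \<rho>)\<rfloor>"
      have "0 \<le> log 2 (z / \<rho>)" using z \<rho> by simp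
      then have "real j \<le> log 2 (z / \<rho>)" "log 2 (z / \<rho>) < real j + 1"
        unfolding j_def by linarith+
      then have "2 powr real j \<le> z / \<rho>" "z / \<rho> < 2 powr (real j + 1)"
        using z \<rho> by (auto simp: le_log_iff log_less_iff)
      then have "z \<le> r j" "\<rho> * 2 powr real j \<le> z"
        using z \<rho> by (auto simp: r_def powr_add field_simps)
      then show "\<exists>j. y \<in> cball x (r j) \<and> norm (x - y) powr - m \<le> b j"
        using m z powr_mono2'[of "- m" "\<rho> * 2 powr real j" z] \<rho>
        by (intro exI[of _ j]) (auto simp: b_def z_def dist_norm)
    qed
    then show "(\<integral>\<^sup>+y. ennreal (norm (x - y) powr - m) * indicator (- ball x \<rho>) y \<partial>lebesgue)
        \<le> ennreal (C * \<rho> powr (real DIM('a) - m))"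
      by (simp add: C_def n_def mult_ac)
  qed
qed

text \<open>Weighted Young applied to \<open>f / F\<close> and \<open>g / G\<close>, then
  integrated. Since \<open>F\<close> and \<open>G\<close> are only upper bounds, they may be any
  convenient estimates; a zero bound is treated apart because it cannot be normalized.\<close>

lemma nn_integral_Holder:
  fixes f g :: "'b \<Rightarrow> real"
  assumes [measurable]: "f \<in> borel_measurable M" "g \<in> borel_measurable M"
    and nonneg: "\<And>x. 0 \<le> f x" "\<And>x. 0 \<le> g x" "0 \<le> F" "0 \<le> G"
    and F: "(\<integral>\<^sup>+x. ennreal (f x) \<partial>M) \<le> ennreal F" and G: "(\<integral>\<^sup>+x. ennreal (g x) \<partial>M) \<le> ennreal G"
    and \<alpha>: "0 < \<alpha>" "0 < \<beta>" "\<alpha> + \<beta> = 1"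
  shows "(\<integral>\<^sup>+x. ennreal (f x powr \<alpha> * g x powr \<beta>) \<partial>M) \<le> ennreal (F powr \<alpha> * G powr \<beta>)"
proof (cases "F = 0 \<or> G = 0")
  case True
  have "AE x in M. f x powr \<alpha> * g x powr \<beta> = 0"
  proof (rule disjE[OF True])
    assume "F = 0"
    then have "AE x in M. f x = 0" using F nonneg by (simp add: nn_integral_0_iff_AE)
    then show ?thesis by eventually_elim simp
  next
    assume "G = 0"
    then have "AE x in M. g x = 0" using G nonneg by (simp add: nn_integral_0_iff_AE)
    then show ?thesis by eventually_elim simp
  qed
  then have "(\<integral>\<^sup>+x. ennreal (f x powr \<alpha> * g x powr \<beta>) \<partial>M) = 0"
    by (subst nn_integral_0_iff_AE) (auto elim: AE_mp)
  then show ?thesis by simp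
next
  case False
  then have pos: "0 < F" "0 < G" using nonneg by auto
  let ?K = "F powr \<alpha> * G powr \<beta>"
  have pt: "f x powr \<alpha> * g x powr \<beta> \<le> ?K * (\<alpha> / F) * f x + ?K * (\<beta> / G) * g x" for x
  proof (cases "f x = 0 \<or> g x = 0")
    case False
    then have "0 < f x" "0 < g x" using nonneg by (simp_all add: less_le)
    then have "(f x / F) powr \<alpha> * (g x / G) powr \<beta> \<le> \<alpha> * (f x / F) + \<beta> * (g x / G)"
      using pos \<alpha> by (intro Youngs_inequality_0) auto
    then have "?K * ((f x / F) powr \<alpha> * (g x / G) powr \<beta>) \<le> ?K * (\<alpha> * (f x / F) + \<beta> * (g x / G))"
      by (intro mult_left_mono) auto
    then show ?thesis using pos nonneg by (simp add: powr_divide algebra_simps)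
  qed (use nonneg pos \<alpha> in auto)
  have "(\<integral>\<^sup>+x. ennreal (f x powr \<alpha> * g x powr \<beta>) \<partial>M)
      \<le> (\<integral>\<^sup>+x. ennreal (?K * (\<alpha> / F)) * ennreal (f x) + ennreal (?K * (\<beta> / G)) * ennreal (g x) \<partial>M)"
    using pos \<alpha> nonneg pt
    by (intro nn_integral_mono) (simp add: ennreal_leI flip: ennreal_mult ennreal_plus)
  also have "\<dots> = ennreal (?K * (\<alpha> / F)) * (\<integral>\<^sup>+x. ennreal (f x) \<partial>M)
      + ennreal (?K * (\<beta> / G)) * (\<integral>\<^sup>+x. ennreal (g x) \<partial>M)"
    by (simp add: nn_integral_add nn_integral_cmult)
  also have "\<dots> \<le> ennreal (?K * (\<alpha> / F)) * ennreal F + ennreal (?K * (\<beta> / G)) * ennreal G"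
    using F G by (intro add_mono mult_left_mono) auto
  also have "\<dots> = ennreal (?K * (\<alpha> / F) * F + ?K * (\<beta> / G) * G)"
    using pos \<alpha> by (simp flip: ennreal_plus ennreal_mult)
  also have "?K * (\<alpha> / F) * F + ?K * (\<beta> / G) * G = ?K"
    using pos \<alpha> by (simp flip: distrib_left)
  finally show ?thesis .
qed

section \<open>The Hardy--Littlewood--Sobolev inequality\<close>

lemma measurable_lebesgue_id: "(\<lambda>x. x) \<in> (lebesgue :: 'a::euclidean_space measure) \<rightarrow>\<^sub>M borel"
  by (rule measurable_completion) simp

text \<open>The double integrals live on the product of two completed measures. Borel functions of
  both variables, such as the kernels, are measurable there because both projections are measurable
  into \<open>borel\<close>.\<close>

lemma measurable_fst_snd_lebesgue [measurable]:
  "fst \<in> (lebesgue \<Otimes>\<^sub>M lebesgue :: ('a::euclidean_space \<times> 'b::euclidean_space) measure) \<rightarrow>\<^sub>M borel"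
  "snd \<in> (lebesgue \<Otimes>\<^sub>M lebesgue :: ('a \<times> 'b) measure) \<rightarrow>\<^sub>M borel"
  by (rule measurable_compose[OF measurable_fst measurable_lebesgue_id]
    measurable_compose[OF measurable_snd measurable_lebesgue_id])+

text \<open>The bound is deliberately not homogeneous in \<open>f\<close>: normalizing beforehand
  restores the scaling, and the inhomogeneous form follows from a pointwise estimate of the inner
  integral by a multiple of \<open>f x powr t\<close>.\<close>

lemma hardy_littlewood_sobolev_diagonal:
  fixes \<mu> :: real
  defines "n \<equiv> real DIM('a::euclidean_space)"
  defines "t \<equiv> 2 * n / (2 * n - \<mu>)"
  assumes \<mu>: "0 < \<mu>" "\<mu> < n"
  shows "\<exists>C\<ge>0. \<forall>(f :: 'a \<Rightarrow> real) N. f \<in> borel_measurable lebesgue \<longrightarrow> (\<forall>x. 0 \<le> f x) \<longrightarrow> 0 \<le> N \<longrightarrow>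
      (\<integral>\<^sup>+x. ennreal (f x powr t) \<partial>lebesgue) \<le> ennreal N \<longrightarrow>
      (\<integral>\<^sup>+x. \<integral>\<^sup>+y. ennreal (f x * f y * norm (x - y) powr - \<mu>) \<partial>lebesgue \<partial>lebesgue)
        \<le> ennreal (2 * (C + N) * N)"
proof -
  define \<kappa> where "\<kappa> = t - 1"
  have n: "0 < n" and n\<mu>: "0 < 2 * n - \<mu>" using \<mu> by (auto simp: n_def)
  have t: "0 < t" "1 / t \<le> 1" "1 / t = 1 - \<mu> / (2 * n)" using n n\<mu> \<mu> by (auto simp: t_def field_simps)
  have \<kappa>: "\<kappa> = \<mu> / (2 * n - \<mu>)" using n n\<mu> by (auto simp: \<kappa>_def t_def field_simps)
  obtain C1 where C1: "C1 \<ge> 0"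
    "\<forall>(x::'a) \<rho>. \<rho> > 0 \<longrightarrow> (\<integral>\<^sup>+y. ennreal (norm (x - y) powr - \<mu>) * indicator (ball x \<rho>) y \<partial>lebesgue)
      \<le> ennreal (C1 * \<rho> powr (n - \<mu>))"
    using nn_integral_kernel_ball[where 'a='a, of \<mu>, folded n_def, OF \<mu>(2) less_imp_le[OF \<mu>(1)]]
    by auto
  obtain C2 where C2: "C2 \<ge> 0"
    "\<forall>(x::'a) \<rho>. \<rho> > 0 \<longrightarrow> (\<integral>\<^sup>+y. ennreal (norm (x - y) powr - (2 * n)) * indicator (- ball x \<rho>) y \<partial>lebesgue)
      \<le> ennreal (C2 * \<rho> powr (n - 2 * n))"
    using nn_integral_kernel_outside_ball[where 'a='a, of "2 * n", folded n_def] n by auto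
  define C where "C = C1 + C2"
  show ?thesis
  proof (intro exI[of _ C] conjI allI impI)
    show "C \<ge> 0" using C1(1) C2(1) by (simp add: C_def)
    fix f :: "'a \<Rightarrow> real" and N :: real
    assume [measurable]: "f \<in> borel_measurable lebesgue" and f: "\<forall>x. 0 \<le> f x" and N0: "0 \<le> N"
      and N: "(\<integral>\<^sup>+x. ennreal (f x powr t) \<partial>lebesgue) \<le> ennreal N"
    let ?G = "\<lambda>x y. ennreal (f x * f y * norm (x - y) powr - \<mu>)"
    \<comment> \<open>The kernel is symmetric, so the pairs with \<open>f y\<close> at most
      \<open>f x\<close> account for at least half of the integral. Exchanging the order of
      integration turns the other half into this one, whence the factor 2.\<close>
    let ?H = "\<lambda>x y. if f y \<le> f x then ?G x y else 0"
    \<comment> \<open>Where \<open>f y \<le> f x\<close>, the near part of the potential is bounded by \<open>f x\<close> itself, so that no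
      maximal function is needed.\<close>
    have inner: "(\<integral>\<^sup>+y. ?H x y \<partial>lebesgue) \<le> ennreal (C + N) * ennreal (f x powr t)" for x
    proof (cases "f x = 0")
      case False
      define F where "F = f x"
      have F: "F > 0" using False f by (simp add: F_def less_le)
      \<comment> \<open>This radius balances the two regions: the near part scales like
        \<open>F powr 2 * \<rho> powr (n - \<mu>)\<close>, the far part like
        \<open>\<rho> powr - n\<close>, and both equal \<open>F powr t\<close>.\<close>
      define \<rho> where "\<rho> = F powr - (t / n)"
      have \<rho>: "\<rho> > 0" using F by (simp add: \<rho>_def)
      have pt: "?H x y \<le> ennreal (F * F) * (ennreal (norm (x - y) powr - \<mu>) * indicator (ball x \<rho>) y)
          + (ennreal (F powr t) * ennreal (f y powr t)
          + ennreal 1 * (ennreal (norm (x - y) powr - (2 * n)) * indicator (- ball x \<rho>) y))" for y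
      proof (cases "f y \<le> F \<and> f y > 0 \<and> x \<noteq> y")
        case True
        then have z: "norm (x - y) > 0" by simp
        show ?thesis
        proof (cases "y \<in> ball x \<rho>")
          case True': True
          have "f x * f y * norm (x - y) powr - \<mu> \<le> F * F * norm (x - y) powr - \<mu>"
            using True F by (auto simp: F_def intro!: mult_right_mono mult_mono)
          then have "?H x y \<le> ennreal (F * F) * (ennreal (norm (x - y) powr - \<mu>) * indicator (ball x \<rho>) y)"
            using True True' F by (auto simp: F_def ennreal_mult[symmetric] ennreal_leI)
          then show ?thesis by (rule order_trans) simp
        next
          case False
          \<comment> \<open>Young with weights \<open>1 / t\<close> and
            \<open>\<mu> / (2 * n)\<close>, which add up to 1, trades the slowly decaying kernel for
            \<open>norm (x - y) powr - (2 * n)\<close>, integrable away from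
            \<open>x\<close>.\<close>
          have "(F powr t * f y powr t) powr (1 / t) * (norm (x - y) powr - (2 * n)) powr (\<mu> / (2 * n))
              \<le> 1 / t * (F powr t * f y powr t) + \<mu> / (2 * n) * norm (x - y) powr - (2 * n)"
            using True F z t n \<mu> by (intro Youngs_inequality_0) auto
          also have "\<dots> \<le> 1 * (F powr t * f y powr t) + 1 * norm (x - y) powr - (2 * n)"
            using t(2) n \<mu> by (intro add_mono mult_right_mono) auto
          also have "(F powr t * f y powr t) powr (1 / t) * (norm (x - y) powr - (2 * n)) powr (\<mu> / (2 * n))
              = f x * f y * norm (x - y) powr - \<mu>"
            using F f t(1) n z by (simp add: powr_mult powr_powr F_def[symmetric])
          finally have "?H x y \<le> ennreal (F powr t * f y powr t + norm (x - y) powr - (2 * n))"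
            using True by (auto simp: F_def simp del: ennreal_plus intro: ennreal_leI)
          then show ?thesis using False F f by (simp add: ennreal_mult)
        qed
      next
        case False
        then have "f x < f y \<or> f y = 0 \<or> x = y" using f[rule_format, of y] by (auto simp: F_def)
        then show ?thesis by auto
      qed
      have "(\<integral>\<^sup>+y. ?H x y \<partial>lebesgue)
          \<le> ennreal (F * F) * (\<integral>\<^sup>+y. ennreal (norm (x - y) powr - \<mu>) * indicator (ball x \<rho>) y \<partial>lebesgue)
          + (ennreal (F powr t) * (\<integral>\<^sup>+y. ennreal (f y powr t) \<partial>lebesgue)
          + ennreal 1 * (\<integral>\<^sup>+y. ennreal (norm (x - y) powr - (2 * n)) * indicator (- ball x \<rho>) y \<partial>lebesgue))"
        by (rule order_trans[OF nn_integral_mono[OF pt]]) (simp add: nn_integral_add nn_integral_cmult)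
      also have "\<dots> \<le> ennreal (F * F) * ennreal (C1 * \<rho> powr (n - \<mu>))
          + (ennreal (F powr t) * ennreal N + ennreal 1 * ennreal (C2 * \<rho> powr (n - 2 * n)))"
        using C1(2) C2(2) \<rho> N by (intro add_mono mult_left_mono) auto
      also have "\<dots> = ennreal (F * F * (C1 * \<rho> powr (n - \<mu>)) + (F powr t * N + C2 * \<rho> powr (n - 2 * n)))"
        using F C1(1) C2(1) N0 by (simp flip: ennreal_plus ennreal_mult)
      also have "F * F * (C1 * \<rho> powr (n - \<mu>)) = C1 * F powr t"
      proof -
        have "F * F * \<rho> powr (n - \<mu>) = F powr (2 - t / n * (n - \<mu>))"
        proof -
          have "F * F = F powr 2" using F by (simp add: power2_eq_square)
          moreover have "\<rho> powr (n - \<mu>) = F powr (- (t / n * (n - \<mu>)))"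
            using F unfolding \<rho>_def by (simp only: powr_powr mult_minus_left)
          ultimately show ?thesis by (simp only: powr_add[symmetric] add_uminus_conv_diff)
        qed
        also have "2 - t / n * (n - \<mu>) = t" using n n\<mu> by (simp add: t_def field_simps)
        finally show ?thesis by (simp add: mult_ac)
      qed
      also have "C2 * \<rho> powr (n - 2 * n) = C2 * F powr t"
        using n by (simp add: \<rho>_def powr_powr)
      also have "C1 * F powr t + (F powr t * N + C2 * F powr t) = (C + N) * F powr t"
        by (simp add: C_def algebra_simps)
      finally show ?thesis using C1(1) C2(1) N0 by (simp add: C_def ennreal_mult F_def)
    next
      case True
      then have "(\<integral>\<^sup>+y. ?H x y \<partial>lebesgue) = (\<integral>\<^sup>+y. 0 \<partial>(lebesgue :: 'a measure))"
        by (intro nn_integral_cong) auto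
      then show ?thesis by simp
    qed
    have meas: "(\<lambda>(x, y). ?H x y) \<in> borel_measurable (lebesgue \<Otimes>\<^sub>M lebesgue)"
      unfolding split_beta by (intro measurable_If borel_measurable_le) measurable
    have meas': "(\<lambda>(x, y). ?H y x) \<in> borel_measurable (lebesgue \<Otimes>\<^sub>M lebesgue)"
      unfolding split_beta by (intro measurable_If borel_measurable_le) measurable
    have "(\<integral>\<^sup>+x. \<integral>\<^sup>+y. ?G x y \<partial>lebesgue \<partial>lebesgue)
        \<le> (\<integral>\<^sup>+x. \<integral>\<^sup>+y. ?H x y + ?H y x \<partial>lebesgue \<partial>lebesgue)"
      by (intro nn_integral_mono) (auto simp: norm_minus_commute mult.commute)
    also have "\<dots> = (\<integral>\<^sup>+x. \<integral>\<^sup>+y. ?H x y \<partial>lebesgue \<partial>lebesgue) + (\<integral>\<^sup>+x. \<integral>\<^sup>+y. ?H y x \<partial>lebesgue \<partial>lebesgue)"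
    proof (subst nn_integral_add[symmetric])
      show "(\<lambda>x. \<integral>\<^sup>+y. ?H x y \<partial>lebesgue) \<in> borel_measurable lebesgue"
        by (rule lebesgue.borel_measurable_nn_integral[OF meas])
      show "(\<lambda>x. \<integral>\<^sup>+y. ?H y x \<partial>lebesgue) \<in> borel_measurable lebesgue"
        by (rule lebesgue.borel_measurable_nn_integral[OF meas'])
      have "(\<integral>\<^sup>+y. ?H x y + ?H y x \<partial>lebesgue)
          = (\<integral>\<^sup>+y. ?H x y \<partial>lebesgue) + (\<integral>\<^sup>+y. ?H y x \<partial>lebesgue)" for x
        using measurable_Pair2[OF meas, of x] measurable_Pair2[OF meas', of x]
        by (intro nn_integral_add) simp_all
      then show "(\<integral>\<^sup>+x. \<integral>\<^sup>+y. ?H x y + ?H y x \<partial>lebesgue \<partial>lebesgue)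
          = (\<integral>\<^sup>+x. (\<integral>\<^sup>+y. ?H x y \<partial>lebesgue) + (\<integral>\<^sup>+y. ?H y x \<partial>lebesgue) \<partial>lebesgue)"
        by (simp only:)
    qed
    also have "(\<integral>\<^sup>+x. \<integral>\<^sup>+y. ?H y x \<partial>lebesgue \<partial>lebesgue) = (\<integral>\<^sup>+x. \<integral>\<^sup>+y. ?H x y \<partial>lebesgue \<partial>lebesgue)"
      using lebesgue_pair.Fubini'[OF meas] by simp
    finally have sym: "(\<integral>\<^sup>+x. \<integral>\<^sup>+y. ?G x y \<partial>lebesgue \<partial>lebesgue)
        \<le> (\<integral>\<^sup>+x. \<integral>\<^sup>+y. ?H x y \<partial>lebesgue \<partial>lebesgue) + (\<integral>\<^sup>+x. \<integral>\<^sup>+y. ?H x y \<partial>lebesgue \<partial>lebesgue)" .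
    have "(\<integral>\<^sup>+x. \<integral>\<^sup>+y. ?H x y \<partial>lebesgue \<partial>lebesgue) \<le> (\<integral>\<^sup>+x. ennreal (C + N) * ennreal (f x powr t) \<partial>lebesgue)"
      by (intro nn_integral_mono inner)
    also have "\<dots> \<le> ennreal (C + N) * ennreal N"
      using N by (simp add: nn_integral_cmult mult_left_mono)
    finally have half: "(\<integral>\<^sup>+x. \<integral>\<^sup>+y. ?H x y \<partial>lebesgue \<partial>lebesgue) \<le> ennreal (C + N) * ennreal N" .
    have "ennreal (C + N) * ennreal N + ennreal (C + N) * ennreal N = ennreal (2 * (C + N) * N)"
      using \<open>C \<ge> 0\<close> N0 by (simp flip: ennreal_mult ennreal_plus)
    then show "(\<integral>\<^sup>+x. \<integral>\<^sup>+y. ?G x y \<partial>lebesgue \<partial>lebesgue) \<le> ennreal (2 * (C + N) * N)"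
      using order_trans[OF sym add_mono[OF half half]] by simp
  qed
qed

text \<open>Polarization by a maximum: after normalization one function \<open>h\<close> dominates
  both factors, so the diagonal case applies to it with bound 2.\<close>

lemma hardy_littlewood_sobolev:
  fixes \<mu> :: real
  defines "n \<equiv> real DIM('a::euclidean_space)"
  defines "t \<equiv> 2 * n / (2 * n - \<mu>)"
  assumes \<mu>: "0 < \<mu>" "\<mu> < n"
  shows "\<exists>C\<ge>0. \<forall>(f :: 'a \<Rightarrow> real) g A B. f \<in> borel_measurable lebesgue \<longrightarrow> g \<in> borel_measurable lebesgue \<longrightarrow>
      (\<forall>x. 0 \<le> f x) \<longrightarrow> (\<forall>x. 0 \<le> g x) \<longrightarrow> 0 \<le> A \<longrightarrow> 0 \<le> B \<longrightarrow>
      (\<integral>\<^sup>+x. ennreal (f x powr t) \<partial>lebesgue) \<le> ennreal A \<longrightarrow>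
      (\<integral>\<^sup>+x. ennreal (g x powr t) \<partial>lebesgue) \<le> ennreal B \<longrightarrow>
      (\<integral>\<^sup>+x. \<integral>\<^sup>+y. ennreal (f x * g y * norm (x - y) powr - \<mu>) \<partial>lebesgue \<partial>lebesgue)
        \<le> ennreal (C * (A powr (1 / t) * B powr (1 / t)))"
proof -
  have t: "0 < t" using \<mu> by (simp add: t_def n_def)
  obtain C where C: "C \<ge> 0"
    "\<forall>(f :: 'a \<Rightarrow> real) N. f \<in> borel_measurable lebesgue \<longrightarrow> (\<forall>x. 0 \<le> f x) \<longrightarrow> 0 \<le> N \<longrightarrow>
      (\<integral>\<^sup>+x. ennreal (f x powr t) \<partial>lebesgue) \<le> ennreal N \<longrightarrow>
      (\<integral>\<^sup>+x. \<integral>\<^sup>+y. ennreal (f x * f y * norm (x - y) powr - \<mu>) \<partial>lebesgue \<partial>lebesgue)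
        \<le> ennreal (2 * (C + N) * N)"
    using hardy_littlewood_sobolev_diagonal[where 'a='a, of \<mu>, folded n_def, folded t_def, OF \<mu>]
    by auto
  show ?thesis
  proof (intro exI[of _ "2 * (C + 2) * 2"] conjI allI impI)
    show "2 * (C + 2) * 2 \<ge> 0" using C by simp
    fix f g :: "'a \<Rightarrow> real" and A B :: real
    assume [measurable]: "f \<in> borel_measurable lebesgue" "g \<in> borel_measurable lebesgue"
      and nonneg: "\<forall>x. 0 \<le> f x" "\<forall>x. 0 \<le> g x" "0 \<le> A" "0 \<le> B"
      and A: "(\<integral>\<^sup>+x. ennreal (f x powr t) \<partial>lebesgue) \<le> ennreal A"
      and B: "(\<integral>\<^sup>+x. ennreal (g x powr t) \<partial>lebesgue) \<le> ennreal B"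
    let ?I = "\<integral>\<^sup>+x. \<integral>\<^sup>+y. ennreal (f x * g y * norm (x - y) powr - \<mu>) \<partial>lebesgue \<partial>lebesgue"
    consider "A = 0" | "B = 0" | "0 < A" "0 < B" using nonneg by linarith
    then show "?I \<le> ennreal (2 * (C + 2) * 2 * (A powr (1 / t) * B powr (1 / t)))"
    proof cases
      case 1
      then have "AE x in lebesgue. f x = 0" using A nonneg by (simp add: nn_integral_0_iff_AE)
      then have "?I = (\<integral>\<^sup>+x. 0 \<partial>(lebesgue :: 'a measure))"
        by (intro nn_integral_cong_AE) (auto elim!: eventually_mono)
      then show ?thesis by simp
    next
      case 2
      then have "AE x in lebesgue. g x = 0" using B nonneg by (simp add: nn_integral_0_iff_AE)
      then have "(\<integral>\<^sup>+y. ennreal (f x * g y * norm (x - y) powr - \<mu>) \<partial>lebesgue) = (\<integral>\<^sup>+y. 0 \<partial>(lebesgue :: 'a measure))" for x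
        by (intro nn_integral_cong_AE) (auto elim!: eventually_mono)
      then show ?thesis by simp
    next
      case 3
      \<comment> \<open>Each normalized function has \<open>t\<close>-th power integral at most 1,
        and the \<open>t\<close>-th power of a maximum is at most the sum of the \<open>t\<close>-th
        powers; hence the bound 2 for \<open>h\<close>.\<close>
      define h where "h = (\<lambda>x. max (f x / A powr (1 / t)) (g x / B powr (1 / t)))"
      have h0: "0 \<le> h x" for x using nonneg by (simp add: h_def le_max_iff_disj)
      have [measurable]: "h \<in> borel_measurable lebesgue" unfolding h_def by measurable
      have "(\<integral>\<^sup>+x. ennreal (h x powr t) \<partial>lebesgue)
          \<le> (\<integral>\<^sup>+x. ennreal (1 / A) * ennreal (f x powr t) + ennreal (1 / B) * ennreal (g x powr t) \<partial>lebesgue)"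
      proof (rule nn_integral_mono)
        fix x
        have "h x powr t \<le> (f x / A powr (1 / t)) powr t + (g x / B powr (1 / t)) powr t"
          by (auto simp: h_def max_def)
        also have "\<dots> = 1 / A * f x powr t + 1 / B * g x powr t"
          using t 3 nonneg by (simp add: powr_divide powr_powr)
        finally show "ennreal (h x powr t) \<le> ennreal (1 / A) * ennreal (f x powr t) + ennreal (1 / B) * ennreal (g x powr t)"
          using 3 by (simp add: ennreal_leI flip: ennreal_mult ennreal_plus)
      qed
      also have "\<dots> \<le> ennreal (1 / A) * ennreal A + ennreal (1 / B) * ennreal B"
        using A B by (simp add: nn_integral_add nn_integral_cmult add_mono mult_left_mono)
      also have "\<dots> = ennreal 2" using 3 by (simp flip: ennreal_mult ennreal_plus)
      finally have h: "(\<integral>\<^sup>+x. ennreal (h x powr t) \<partial>lebesgue) \<le> ennreal 2" .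
      let ?k = "A powr (1 / t) * B powr (1 / t)"
      have "?I \<le> (\<integral>\<^sup>+x. ennreal ?k * (\<integral>\<^sup>+y. ennreal (h x * h y * norm (x - y) powr - \<mu>) \<partial>lebesgue) \<partial>lebesgue)"
      proof (subst nn_integral_cmult[symmetric], measurable, intro nn_integral_mono)
        fix x y
        have "f x \<le> A powr (1 / t) * h x" "g y \<le> B powr (1 / t) * h y"
          using 3 by (simp_all add: h_def max_def field_simps)
        then have "f x * g y \<le> (A powr (1 / t) * h x) * (B powr (1 / t) * h y)"
          using nonneg h0 by (intro mult_mono) auto
        then have "f x * g y * norm (x - y) powr - \<mu> \<le> (A powr (1 / t) * h x) * (B powr (1 / t) * h y) * norm (x - y) powr - \<mu>"
          by (intro mult_right_mono) auto
        then show "ennreal (f x * g y * norm (x - y) powr - \<mu>) \<le> ennreal ?k * ennreal (h x * h y * norm (x - y) powr - \<mu>)"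
          using h0 by (simp add: ennreal_leI mult_ac flip: ennreal_mult)
      qed
      also have "\<dots> = ennreal ?k * (\<integral>\<^sup>+x. \<integral>\<^sup>+y. ennreal (h x * h y * norm (x - y) powr - \<mu>) \<partial>lebesgue \<partial>lebesgue)"
        by (rule nn_integral_cmult) measurable
      also have "\<dots> \<le> ennreal ?k * ennreal (2 * (C + 2) * 2)"
        using C(2)[rule_format, of h 2] h h0 by (intro mult_left_mono) auto
      also have "\<dots> = ennreal (2 * (C + 2) * 2 * ?k)"
        using C(1) by (subst ennreal_mult[symmetric]) (simp_all only: mult.commute, simp_all)
      finally show ?thesis .
    qed
  qed
qed

section \<open>The fractional Sobolev inequality and De Giorgi's lemma\<close>

text \<open>By Chebyshev's inequality \<open>\<bar>v\<bar> \<le> \<bar>v x\<bar> / 2\<close> on at least half of a ball around \<open>x\<close> whose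
  volume is a multiple of \<open>N / \<bar>v x\<bar>\<^sup>P\<close>; there the difference quotient is large.\<close>

lemma sobolev_pointwise:
  fixes v :: "'a::euclidean_space \<Rightarrow> real" and s :: real
  defines "n \<equiv> real DIM('a)"
  defines "P \<equiv> 2 * n / (n - 2 * s)"
  defines "V \<equiv> unit_ball_vol n"
  assumes s: "0 < s" "2 * s < n" and [measurable]: "v \<in> borel_measurable lebesgue"
    and N: "(\<integral>\<^sup>+y. ennreal (\<bar>v y\<bar> powr P) \<partial>lebesgue) = ennreal N" "0 < N"
  shows "ennreal (\<bar>v x\<bar> powr P) \<le> ennreal (8 / V * (2 * 2 powr P / V) powr (2 * s / n) * N powr (2 * s / n))
    * (\<integral>\<^sup>+y. ennreal (\<bar>v x - v y\<bar> powr 2 * norm (x - y) powr - (n + 2 * s)) \<partial>lebesgue)"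
proof (cases "v x = 0")
  case False
  define F where "F = \<bar>v x\<bar>"
  have F: "F > 0" using False by (simp add: F_def)
  have n: "n > 0" by (simp add: n_def)
  have P: "P > 0" using s n by (simp add: P_def)
  have V: "V > 0" by (simp add: V_def n_def)
  \<comment> \<open>Chebyshev's bound for the measure of the set where \<open>\<bar>v\<bar>\<close>
    exceeds \<open>F / 2\<close>. The radius below makes the volume of the ball
    \<open>2 * M\<close>, so at least measure \<open>M\<close> of it remains in
    \<open>E\<close>.\<close>
  define M where "M = 2 powr P * N / F powr P"
  have M: "M > 0" using N F by (simp add: M_def)
  define \<rho> where "\<rho> = (2 * M / V) powr (1 / n)"
  have \<rho>: "\<rho> > 0" using M V by (simp add: \<rho>_def)
  have \<rho>n: "\<rho> ^ DIM('a) = 2 * M / V"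
    using M V by (simp add: \<rho>_def powr_powr n_def flip: powr_realpow)
  define E where "E = {y. \<bar>v y\<bar> \<le> F / 2}"
  have "{y \<in> space lebesgue. \<bar>v y\<bar> \<le> F / 2} \<in> sets lebesgue" by measurable
  then have E [measurable]: "E \<in> sets lebesgue" by (simp add: E_def)
  then have [measurable]: "- E \<in> sets lebesgue"
    using sets.compl_sets[OF E] by (simp add: Compl_eq_Diff_UNIV)
  have "emeasure lebesgue (- E) \<le> ennreal M"
  proof -
    have "emeasure lebesgue (- E) = (\<integral>\<^sup>+y. indicator (- E) y \<partial>lebesgue)" by simp
    also have "\<dots> \<le> (\<integral>\<^sup>+y. ennreal (2 powr P / F powr P) * ennreal (\<bar>v y\<bar> powr P) \<partial>lebesgue)"
    proof (rule nn_integral_mono)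
      fix y
      show "indicator (- E) y \<le> ennreal (2 powr P / F powr P) * ennreal (\<bar>v y\<bar> powr P)"
      proof (cases "y \<in> E")
        case False
        then have "(F / 2) powr P \<le> \<bar>v y\<bar> powr P" using F P by (intro powr_mono2) (auto simp: E_def)
        then have "1 \<le> 2 powr P / F powr P * \<bar>v y\<bar> powr P"
          using F by (simp add: powr_divide field_simps)
        then show ?thesis using False by (simp add: ennreal_leI flip: ennreal_mult ennreal_1)
      qed simp
    qed
    also have "\<dots> = ennreal (2 powr P / F powr P) * ennreal N"
      using N(1) by (simp add: nn_integral_cmult)
    also have "\<dots> = ennreal M" using N(2) by (simp add: M_def flip: ennreal_mult)
    finally show ?thesis .
  qed
  moreover have "ennreal (2 * M) = emeasure lebesgue (ball x \<rho>)"
    using emeasure_lebesgue_ball[of \<rho> x] \<rho> \<rho>n V unfolding V_def n_def by simp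
  moreover have "emeasure lebesgue (ball x \<rho>) \<le> emeasure lebesgue (ball x \<rho> \<inter> E) + emeasure lebesgue (- E)"
    by (rule order_trans[OF emeasure_mono emeasure_subadditive]) auto
  ultimately have "ennreal (2 * M) \<le> emeasure lebesgue (ball x \<rho> \<inter> E) + ennreal M"
    by (auto intro: order_trans add_left_mono)
  moreover have "ennreal (2 * M) = ennreal M + ennreal M"
    using M by (simp flip: ennreal_plus)
  ultimately have half: "ennreal M \<le> emeasure lebesgue (ball x \<rho> \<inter> E)"
    by (simp add: ennreal_add_left_cancel_le add.commute)
  define c where "c = F\<^sup>2 / 4 * \<rho> powr - (n + 2 * s)"
  have c: "c > 0" using F \<rho> by (simp add: c_def)
  have "ennreal c * ennreal M \<le> (\<integral>\<^sup>+y. ennreal c * indicator (ball x \<rho> \<inter> E) y \<partial>lebesgue)"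
    using half by (simp add: nn_integral_cmult mult_left_mono)
  also have "\<dots> \<le> (\<integral>\<^sup>+y. ennreal (\<bar>v x - v y\<bar> powr 2 * norm (x - y) powr - (n + 2 * s)) \<partial>lebesgue)"
  proof (rule nn_integral_mono)
    fix y
    show "ennreal c * indicator (ball x \<rho> \<inter> E) y \<le> ennreal (\<bar>v x - v y\<bar> powr 2 * norm (x - y) powr - (n + 2 * s))"
    proof (cases "y \<in> ball x \<rho> \<inter> E")
      case True
      then have "\<bar>v y\<bar> \<le> \<bar>v x\<bar> / 2" by (simp add: E_def F_def)
      then have d: "F / 2 \<le> \<bar>v x - v y\<bar>" unfolding F_def by linarith
      then have "x \<noteq> y" using F by auto
      have "(F / 2) powr 2 \<le> \<bar>v x - v y\<bar> powr 2" using d F by (intro powr_mono2) auto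
      moreover have "\<rho> powr - (n + 2 * s) \<le> norm (x - y) powr - (n + 2 * s)"
        using True \<open>x \<noteq> y\<close> s n by (intro powr_mono2') (auto simp: dist_norm)
      ultimately have "(F / 2) powr 2 * \<rho> powr - (n + 2 * s) \<le> \<bar>v x - v y\<bar> powr 2 * norm (x - y) powr - (n + 2 * s)"
        by (intro mult_mono) auto
      then show ?thesis using True F by (auto simp: c_def power_divide intro!: ennreal_leI)
    qed simp
  qed
  finally have main: "ennreal (c * M) \<le> (\<integral>\<^sup>+y. ennreal (\<bar>v x - v y\<bar> powr 2 * norm (x - y) powr - (n + 2 * s)) \<partial>lebesgue)"
    using c M by (simp add: ennreal_mult)
  \<comment> \<open>The factor is the quotient of \<open>F powr P\<close> by the lower bound
    \<open>c * M\<close>. It no longer contains \<open>F\<close> because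
    \<open>2 + P * (2 * s / n) = P\<close>, the defining relation of the Sobolev exponent.\<close>
  let ?K = "8 / V * (2 * 2 powr P / V) powr (2 * s / n) * N powr (2 * s / n)"
  have "?K * (c * M) = F powr P"
  proof -
    have "\<rho> powr - (n + 2 * s) = (2 * M / V) powr (- 1 - 2 * s / n)"
    proof -
      have "1 / n * - (n + 2 * s) = - 1 - 2 * s / n" using n by (simp add: field_simps)
      then show ?thesis by (simp only: \<rho>_def powr_powr)
    qed
    also have "\<dots> = (V / (2 * M)) * (2 * M / V) powr (- (2 * s / n))"
      using M V powr_add[of "2 * M / V" "- 1" "- (2 * s / n)"] by (simp add: powr_minus_divide)
    also have "2 * M / V = (2 * 2 powr P / V) * N * F powr - P"
      by (simp add: M_def powr_minus divide_simps)
    also have "\<dots> powr (- (2 * s / n)) = (2 * 2 powr P / V) powr (- (2 * s / n)) * N powr (- (2 * s / n)) * F powr (P * (2 * s / n))"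
      by (simp only: powr_mult powr_powr minus_mult_minus)
    finally have "?K * (c * M) = F\<^sup>2 * F powr (P * (2 * s / n))"
      using V N M by (simp add: c_def powr_minus field_simps)
    also have "\<dots> = F powr (2 + P * (2 * s / n))" using F by (simp add: powr_add)
    also have "2 + P * (2 * s / n) = P" using n s by (simp add: P_def field_simps)
    finally show ?thesis .
  qed
  then have "ennreal (\<bar>v x\<bar> powr P) = ennreal ?K * ennreal (c * M)"
    using V c M by (simp add: F_def flip: ennreal_mult)
  also have "\<dots> \<le> ennreal ?K * (\<integral>\<^sup>+y. ennreal (\<bar>v x - v y\<bar> powr 2 * norm (x - y) powr - (n + 2 * s)) \<partial>lebesgue)"
    by (intro mult_left_mono main) simp
  finally show ?thesis .
qed simp

text \<open>Integrating the pointwise estimate gives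
  \<open>N \<le> K * N powr (2 * s / n) * D\<close>, and dividing by the power of \<open>N\<close>
  leaves \<open>N powr (2 / P)\<close> on the left. The outer variable only needs to run over
  \<Omega>, since \<open>v\<close> vanishes elsewhere; this matches the region of integration of the
  energy.\<close>

lemma fractional_sobolev:
  fixes s :: real
  defines "n \<equiv> real DIM('a::euclidean_space)"
  defines "P \<equiv> 2 * n / (n - 2 * s)"
  assumes s: "0 < s" "2 * s < n"
  shows "\<exists>S\<ge>0. \<forall>\<Omega> (v::'a \<Rightarrow> real) D. v \<in> borel_measurable lebesgue \<longrightarrow> \<Omega> \<in> lmeasurable \<longrightarrow>
      (AE x in lebesgue. x \<notin> \<Omega> \<longrightarrow> v x = 0) \<longrightarrow> 0 \<le> D \<longrightarrow>
      (\<integral>\<^sup>+x. indicator \<Omega> x * (\<integral>\<^sup>+y. ennreal (\<bar>v x - v y\<bar> powr 2 * norm (x - y) powr - (n + 2 * s)) \<partial>lebesgue) \<partial>lebesgue)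
        \<le> ennreal D \<longrightarrow>
      (\<integral>\<^sup>+x. ennreal (\<bar>v x\<bar> powr P) \<partial>lebesgue) \<le> ennreal (S * D powr (P / 2))"
proof -
  let ?U = "\<lambda>(v::'a \<Rightarrow> real) x. \<integral>\<^sup>+y. ennreal (\<bar>v x - v y\<bar> powr 2 * norm (x - y) powr - (n + 2 * s)) \<partial>lebesgue"
  define K where "K = 8 / unit_ball_vol n * (2 * 2 powr P / unit_ball_vol n) powr (2 * s / n)"
  have n: "n > 0" by (simp add: n_def)
  have P: "P > 0" "2 / P = 1 - 2 * s / n" using s n by (auto simp: P_def field_simps)
  have K: "K \<ge> 0" by (simp add: K_def n_def)
  \<comment> \<open>The division requires \<open>N\<close> to be finite. Boundedness on a set of
    finite measure guarantees this; the truncations \<open>w k\<close> below then pass the estimate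
    to general \<open>v\<close>, since truncation does not increase differences.\<close>
  have bounded_case: "(\<integral>\<^sup>+x. ennreal (\<bar>v x\<bar> powr P) \<partial>lebesgue) \<le> ennreal (K powr (P / 2) * D powr (P / 2))"
    if [measurable]: "v \<in> borel_measurable lebesgue" and \<Omega>: "\<Omega> \<in> lmeasurable"
      and zero: "AE x in lebesgue. x \<notin> \<Omega> \<longrightarrow> v x = 0" and D: "0 \<le> D"
      and energy: "(\<integral>\<^sup>+x. indicator \<Omega> x * ?U v x \<partial>lebesgue) \<le> ennreal D"
      and bdd: "\<And>x. \<bar>v x\<bar> \<le> k" for v :: "'a \<Rightarrow> real" and \<Omega> D k
  proof -
    have [measurable]: "\<Omega> \<in> sets lebesgue" using \<Omega> by (rule fmeasurableD)
    have ind: "(\<integral>\<^sup>+x. ennreal (\<bar>v x\<bar> powr P) \<partial>lebesgue) = (\<integral>\<^sup>+x. indicator \<Omega> x * ennreal (\<bar>v x\<bar> powr P) \<partial>lebesgue)"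
      using zero by (intro nn_integral_cong_AE) (auto elim!: eventually_mono simp: indicator_def)
    have "(\<integral>\<^sup>+x. ennreal (\<bar>v x\<bar> powr P) \<partial>lebesgue) \<le> (\<integral>\<^sup>+x. ennreal (k powr P) * indicator \<Omega> x \<partial>lebesgue)"
      unfolding ind using bdd P
      by (intro nn_integral_mono) (auto simp: indicator_def intro!: ennreal_leI powr_mono2)
    also have "\<dots> < \<infinity>"
      using fmeasurableD2[OF \<Omega>] by (simp add: nn_integral_cmult ennreal_mult_less_top less_top)
    finally obtain N where N: "0 \<le> N" "(\<integral>\<^sup>+x. ennreal (\<bar>v x\<bar> powr P) \<partial>lebesgue) = ennreal N"
      by (cases "\<integral>\<^sup>+x. ennreal (\<bar>v x\<bar> powr P) \<partial>lebesgue") auto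
    show ?thesis
    proof (cases "N = 0")
      case False
      then have N0: "N > 0" using N by simp
      have "(\<integral>\<^sup>+x. ennreal (\<bar>v x\<bar> powr P) \<partial>lebesgue)
          \<le> (\<integral>\<^sup>+x. ennreal (K * N powr (2 * s / n)) * (indicator \<Omega> x * ?U v x) \<partial>lebesgue)"
        unfolding ind
      proof (rule nn_integral_mono)
        fix x
        show "indicator \<Omega> x * ennreal (\<bar>v x\<bar> powr P) \<le> ennreal (K * N powr (2 * s / n)) * (indicator \<Omega> x * ?U v x)"
          using sobolev_pointwise[where s = s and v = v and N = N and x = x, folded n_def, folded P_def, OF s _ N(2) N0]
          by (cases "x \<in> \<Omega>") (auto simp: K_def)
      qed
      also have "\<dots> = ennreal (K * N powr (2 * s / n)) * (\<integral>\<^sup>+x. indicator \<Omega> x * ?U v x \<partial>lebesgue)"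
        by (intro nn_integral_cmult) measurable
      also have "\<dots> \<le> ennreal (K * N powr (2 * s / n)) * ennreal D"
        using energy by (rule mult_left_mono) simp
      finally have "N \<le> K * N powr (2 * s / n) * D"
        using K D N by (simp flip: ennreal_mult)
      then have "N * N powr (- (2 * s / n)) \<le> K * N powr (2 * s / n) * D * N powr (- (2 * s / n))"
        by (rule mult_right_mono) simp
      also have "\<dots> = K * D" using N0 by (simp add: powr_minus field_simps)
      also have "N * N powr (- (2 * s / n)) = N powr (2 / P)"
        using powr_add[of N 1 "- (2 * s / n)"] N0 P by simp
      finally have "(N powr (2 / P)) powr (P / 2) \<le> (K * D) powr (P / 2)"
        using P by (intro powr_mono2) auto
      then have "N \<le> K powr (P / 2) * D powr (P / 2)"
        using N0 P(1) by (simp add: powr_powr powr_mult)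
      then show ?thesis using N by (simp add: ennreal_leI)
    qed (use N in simp)
  qed
  show ?thesis
  proof (intro exI[of _ "K powr (P / 2)"] conjI allI impI)
    fix \<Omega> and v :: "'a \<Rightarrow> real" and D
    assume [measurable]: "v \<in> borel_measurable lebesgue" and \<Omega>: "\<Omega> \<in> lmeasurable"
      and zero: "AE x in lebesgue. x \<notin> \<Omega> \<longrightarrow> v x = 0" and D: "0 \<le> D"
      and energy: "(\<integral>\<^sup>+x. indicator \<Omega> x * ?U v x \<partial>lebesgue) \<le> ennreal D"
    define w where "w = (\<lambda>(k::nat) x. max (- real k) (min (real k) (v x)))"
    have [measurable]: "w k \<in> borel_measurable lebesgue" for k unfolding w_def by measurable
    have "(\<integral>\<^sup>+x. ennreal (\<bar>w k x\<bar> powr P) \<partial>lebesgue) \<le> ennreal (K powr (P / 2) * D powr (P / 2))" for k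
    proof (rule bounded_case[OF _ \<Omega> _ D])
      show "AE x in lebesgue. x \<notin> \<Omega> \<longrightarrow> w k x = 0"
        using zero by eventually_elim (auto simp: w_def)
      show "\<bar>w k x\<bar> \<le> real k" for x by (auto simp: w_def)
      have "\<bar>w k x - w k y\<bar> powr 2 \<le> \<bar>v x - v y\<bar> powr 2" for x y
        by (intro powr_mono2) (auto simp: w_def)
      then have "(\<integral>\<^sup>+x. indicator \<Omega> x * ?U (w k) x \<partial>lebesgue) \<le> (\<integral>\<^sup>+x. indicator \<Omega> x * ?U v x \<partial>lebesgue)"
        by (intro nn_integral_mono mult_left_mono ennreal_leI mult_right_mono) auto
      then show "(\<integral>\<^sup>+x. indicator \<Omega> x * ?U (w k) x \<partial>lebesgue) \<le> ennreal D" using energy by simp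
    qed measurable
    moreover have "(\<lambda>k. \<integral>\<^sup>+x. ennreal (\<bar>w k x\<bar> powr P) \<partial>lebesgue) \<longlonglongrightarrow> (\<integral>\<^sup>+x. ennreal (\<bar>v x\<bar> powr P) \<partial>lebesgue)"
    proof (rule nn_integral_LIMSEQ)
      show "incseq (\<lambda>k x. ennreal (\<bar>w k x\<bar> powr P))"
        using P by (auto simp: incseq_def le_fun_def w_def intro!: ennreal_leI powr_mono2)
      fix x
      have "eventually (\<lambda>k. w k x = v x) sequentially"
        using eventually_ge_at_top[of "nat \<lceil>\<bar>v x\<bar>\<rceil>"]
        by eventually_elim (auto simp: w_def max_def min_def)
      then show "(\<lambda>k. ennreal (\<bar>w k x\<bar> powr P)) \<longlonglongrightarrow> ennreal (\<bar>v x\<bar> powr P)"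
        by (intro tendsto_eventually) (auto elim: eventually_mono)
    qed measurable
    ultimately show "(\<integral>\<^sup>+x. ennreal (\<bar>v x\<bar> powr P) \<partial>lebesgue) \<le> ennreal (K powr (P / 2) * D powr (P / 2))"
      by (intro LIMSEQ_le_const2) auto
  qed simp
qed

text \<open>Here \<open>m k\<close> stands for the measure of \<open>{u > k}\<close>. The
  superlinear power \<open>1 + \<epsilon>\<close> lets \<open>m\<close> decay geometrically along
  levels whose increments are summable, so \<open>m\<close> vanishes at their finite limit.\<close>

lemma de_giorgi:
  fixes m :: "real \<Rightarrow> real"
  assumes nonneg: "\<And>k. 0 \<le> m k" and anti: "\<And>h k. k \<le> h \<Longrightarrow> m h \<le> m k"
    and P: "0 < P" and \<epsilon>: "0 < \<epsilon>"
    and decay: "\<And>h k. k0 \<le> k \<Longrightarrow> k < h \<Longrightarrow> m h \<le> C * (h - k) powr - P * m k powr (1 + \<epsilon>)"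
  shows "\<exists>h. m h = 0"
proof -
  define M where "M = m k0 + 1"
  define B where "B = \<bar>C\<bar> + 1"
  have M: "M > 0" and B: "B > 0" "C \<le> B" using nonneg[of k0] by (auto simp: M_def B_def)
  \<comment> \<open>The increments \<open>A * q ^ j\<close> of the levels cost a factor
    \<open>2 powr (\<epsilon> * j)\<close>, which is exactly the surplus provided by raising
    \<open>2 powr - j\<close> to the power \<open>1 + \<epsilon>\<close>.\<close>
  define q where "q = 2 powr - (\<epsilon> / P)"
  have q: "0 < q" "q < 1" using P \<epsilon> by (auto simp: q_def powr_less_one)
  \<comment> \<open>The first increment is chosen so that the remaining constant in each step is
    exactly one half.\<close>
  define A where "A = (2 * B * M powr \<epsilon>) powr (1 / P)"
  have A: "A > 0" using B M by (simp add: A_def)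
  define k where "k = (\<lambda>j::nat. k0 + A * (1 - q ^ j) / (1 - q))"
  have k: "k0 \<le> k j" "k j \<le> k0 + A / (1 - q)" for j
    using A q by (auto simp: k_def power_le_one divide_right_mono)
  have step: "k (Suc j) - k j = A * q ^ j" for j
  proof -
    have "k (Suc j) - k j = A * q ^ j * (1 - q) / (1 - q)"
      by (simp add: k_def algebra_simps flip: diff_divide_distrib)
    then show ?thesis using q by simp
  qed
  have bound: "m (k j) \<le> M * 2 powr - real j" for j
  proof (induction j)
    case 0
    then show ?case by (simp add: M_def k_def)
  next
    case (Suc j)
    have "m (k (Suc j)) \<le> C * (k (Suc j) - k j) powr - P * m (k j) powr (1 + \<epsilon>)"
      using step[of j] A q by (intro decay k) (smt (verit) mult_pos_pos zero_less_power)
    also have "\<dots> \<le> B * (A * q ^ j) powr - P * (M * 2 powr - real j) powr (1 + \<epsilon>)"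
      unfolding step using B Suc nonneg \<epsilon>
      by (intro mult_mono[OF mult_right_mono powr_mono2]) auto
    also have "(A * q ^ j) powr - P = 1 / (2 * B * M powr \<epsilon>) * 2 powr (\<epsilon> * real j)"
    proof -
      have "q ^ j = 2 powr (- (\<epsilon> / P) * real j)" by (simp add: q_def powr_powr flip: powr_realpow)
      then have "(q ^ j) powr - P = 2 powr (\<epsilon> * real j)" using P by (simp add: powr_powr)
      moreover have "A powr - P = 1 / (2 * B * M powr \<epsilon>)"
        using P B M by (simp add: A_def powr_powr powr_minus_divide)
      ultimately show ?thesis by (simp only: powr_mult)
    qed
    also have "(M * 2 powr - real j) powr (1 + \<epsilon>) = M * M powr \<epsilon> * (2 powr - real j * 2 powr (- (\<epsilon> * real j)))"
    proof -
      have "M powr (1 + \<epsilon>) = M * M powr \<epsilon>" using M by (simp add: powr_add)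
      moreover have "(2 powr - real j) powr (1 + \<epsilon>) = 2 powr - real j * 2 powr (- (\<epsilon> * real j))"
        by (simp add: powr_powr algebra_simps flip: powr_add)
      ultimately show ?thesis by (simp only: powr_mult)
    qed
    also have "B * (1 / (2 * B * M powr \<epsilon>) * 2 powr (\<epsilon> * real j)) * (M * M powr \<epsilon> * (2 powr - real j * 2 powr (- (\<epsilon> * real j))))
        = M * (2 powr - real j / 2)"
      using B M by (simp add: powr_minus field_simps)
    also have "2 powr - real j / 2 = 2 powr (- real j + - 1)"
      by (simp only: powr_add) (simp add: powr_minus_divide)
    also have "- real j + - 1 = - real (Suc j)" by simp
    finally show ?case .
  qed
  have "(\<lambda>j. M * 2 powr - real j) \<longlonglongrightarrow> M * 0"
  proof (intro tendsto_intros)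
    have "(\<lambda>j. (1 / 2 :: real) ^ j) \<longlonglongrightarrow> 0" by (rule LIMSEQ_power_zero) simp
    then show "(\<lambda>j. 2 powr - real j :: real) \<longlonglongrightarrow> 0"
      by (simp add: powr_minus powr_realpow power_one_over inverse_eq_divide)
  qed
  moreover have "m (k0 + A / (1 - q)) \<le> M * 2 powr - real j" for j
    using anti[OF k(2)[of j]] bound[of j] by linarith
  ultimately have "m (k0 + A / (1 - q)) \<le> 0"
    by (intro LIMSEQ_le_const[of "\<lambda>j. M * 2 powr - real j" 0]) auto
  then show ?thesis using nonneg[of "k0 + A / (1 - q)"] by (intro exI) (rule antisym)
qed

text \<open>Valid without integrability, since the Bochner integral then has the value 0. The
  reaction terms can therefore be estimated before anything is known about their
  convergence.\<close>

lemma ennreal_integral_le: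
  "ennreal (integral\<^sup>L M f) \<le> (\<integral>\<^sup>+x. ennreal (f x) \<partial>M)"
proof (cases "integrable M f")
  case True
  have "ennreal (integral\<^sup>L M f) \<le> ennreal (\<integral>x. max 0 (f x) \<partial>M)"
    using True by (intro ennreal_leI integral_mono) auto
  also have "\<dots> = (\<integral>\<^sup>+x. ennreal (max 0 (f x)) \<partial>M)"
    using True by (intro nn_integral_eq_integral[symmetric]) auto
  also have "\<dots> = (\<integral>\<^sup>+x. ennreal (f x) \<partial>M)"
    by (simp add: max_def ennreal_neg cong: if_cong) (auto intro!: nn_integral_cong simp: ennreal_neg)
  finally show ?thesis .
qed (simp add: not_integrable_integral_eq)

section \<open>Test functions\<close>

text \<open>A difference version of \<tau> h'(\<tau>) \<le> m h(\<tau>) for h(\<tau>) =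
  \<open>min \<tau> M ^ m\<close>. Above the cap nothing changes; below it the claim is Bernoulli's
  inequality for the ratio of \<open>b\<close> to the capped \<open>d\<close>.\<close>

lemma truncated_power_aux:
  fixes b d M :: real
  assumes "0 \<le> b" "b \<le> d" "0 \<le> M"
  shows "b * (min d M ^ m - min b M ^ m) \<le> real m * ((d - b) * min d M ^ m)"
proof (cases "M \<le> b \<or> b = 0")
  case True
  then have "min d M = min b M \<or> b = 0" using assms by (auto simp: min_def)
  then show ?thesis using assms by auto
next
  case False
  define e where "e = min d M"
  have b: "b < M" "b \<le> e" "0 < e" "e \<le> d" using False assms by (auto simp: e_def min_def)
  have "1 + real m * (b / e - 1) \<le> (1 + (b / e - 1)) ^ m"
    using b assms by (intro Bernoulli_inequality) simp
  then have "(1 + real m * (b / e - 1)) * e ^ m \<le> (b / e) ^ m * e ^ m"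
    using b by (intro mult_right_mono) auto
  then have "e ^ m - b ^ m \<le> real m * ((e - b) / e) * e ^ m"
    using b by (simp add: power_divide field_simps)
  then have "b * (e ^ m - b ^ m) \<le> b * (real m * ((e - b) / e) * e ^ m)"
    using assms by (intro mult_left_mono) auto
  also have "\<dots> = (b / e) * (real m * ((e - b) * e ^ m))" using b by simp
  also have "\<dots> \<le> 1 * (real m * ((d - b) * e ^ m))"
    using b assms by (intro mult_mono mult_left_mono mult_right_mono) auto
  finally show ?thesis using b assms by (simp add: e_def)
qed

text \<open>Testing with \<phi> controls the energy of \<open>w\<close>. The model is the pointwise
  relation (w')^2 \<le> (1 + m)^2 \<phi>' between derivatives, carried over to differences. The
  Lipschitz constant of \<phi> depends on \<open>M\<close> but is needed only for admissibility; the
  constant of the energy estimate is independent of \<open>M\<close>, which permits letting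
  \<open>M\<close> tend to infinity.\<close>

lemma truncated_power:
  fixes M :: real and m :: nat
  defines "h \<equiv> \<lambda>\<tau>. min (max \<tau> 0) M ^ m"
  defines "\<phi> \<equiv> \<lambda>\<tau>. max \<tau> 0 * (h \<tau>)\<^sup>2" and "w \<equiv> \<lambda>\<tau>. max \<tau> 0 * h \<tau>"
  assumes M: "0 \<le> M"
  shows "mono \<phi>" "\<bar>\<phi> x - \<phi> y\<bar> \<le> (1 + 2 * real m) * M ^ (2 * m) * \<bar>x - y\<bar>"
    "(w x - w y)\<^sup>2 \<le> (1 + real m)\<^sup>2 * ((x - y) * (\<phi> x - \<phi> y))"
proof -
  have main: "\<phi> b \<le> \<phi> d \<and> \<phi> d - \<phi> b \<le> (1 + 2 * real m) * M ^ (2 * m) * (d - b)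
      \<and> (w d - w b)\<^sup>2 \<le> (1 + real m)\<^sup>2 * ((d - b) * (\<phi> d - \<phi> b))" if bd: "b \<le> d" for b d
  proof -
    let ?b = "max b 0" and ?d = "max d 0"
    have pos: "0 \<le> ?b" "?b \<le> ?d" "?d - ?b \<le> d - b" using bd by auto
    have h: "0 \<le> h b" "h b \<le> h d" "h d \<le> M ^ m"
      using M pos by (auto simp: h_def intro!: power_mono)
    have aux: "?b * (h d - h b) \<le> real m * ((?d - ?b) * h d)"
      unfolding h_def using pos M by (intro truncated_power_aux) auto
    have \<phi>: "\<phi> d - \<phi> b = (?d - ?b) * (h d)\<^sup>2 + ?b * (h d - h b) * (h d + h b)"
      by (simp add: \<phi>_def power2_eq_square algebra_simps)
    have low: "(?d - ?b) * (h d)\<^sup>2 \<le> \<phi> d - \<phi> b" unfolding \<phi> using h pos by simp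
    have nn: "0 \<le> (?d - ?b) * (h d)\<^sup>2" using pos by simp
    have "?b * (h d - h b) * (h d + h b) \<le> real m * ((?d - ?b) * h d) * (2 * h d)"
      using h pos by (intro mult_mono aux) auto
    then have "\<phi> d - \<phi> b \<le> (1 + 2 * real m) * ((?d - ?b) * (h d)\<^sup>2)"
      unfolding \<phi> by (simp add: power2_eq_square algebra_simps)
    also have "\<dots> \<le> (1 + 2 * real m) * ((d - b) * (M ^ m)\<^sup>2)"
      using h pos bd by (intro mult_left_mono mult_mono power_mono) auto
    finally have up: "\<phi> d - \<phi> b \<le> (1 + 2 * real m) * M ^ (2 * m) * (d - b)"
      by (simp add: power_mult mult_ac flip: power_mult)
    have w: "w d - w b = (?d - ?b) * h d + ?b * (h d - h b)" by (simp add: w_def algebra_simps)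
    have "w d - w b \<le> (1 + real m) * ((?d - ?b) * h d)" unfolding w using aux by (simp add: algebra_simps)
    moreover have "0 \<le> w d - w b" unfolding w using h pos by simp
    ultimately have "(w d - w b)\<^sup>2 \<le> ((1 + real m) * ((?d - ?b) * h d))\<^sup>2" by (rule power_mono)
    also have "\<dots> = (1 + real m)\<^sup>2 * ((?d - ?b) * ((?d - ?b) * (h d)\<^sup>2))"
      by (simp add: power2_eq_square)
    also have "\<dots> \<le> (1 + real m)\<^sup>2 * ((d - b) * (\<phi> d - \<phi> b))"
      using low pos nn bd by (intro mult_left_mono mult_mono) auto
    finally show ?thesis using up low nn by linarith
  qed
  show "mono \<phi>" using main by (auto intro: monoI)
  consider "x \<le> y" | "y \<le> x" by linarith
  then show "\<bar>\<phi> x - \<phi> y\<bar> \<le> (1 + 2 * real m) * M ^ (2 * m) * \<bar>x - y\<bar>"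
  proof cases
    case 1
    then show ?thesis using main[OF 1] by (simp add: abs_minus_commute)
  next
    case 2
    then show ?thesis using main[OF 2] by simp
  qed
  consider "x \<le> y" | "y \<le> x" by linarith
  then show "(w x - w y)\<^sup>2 \<le> (1 + real m)\<^sup>2 * ((x - y) * (\<phi> x - \<phi> y))"
  proof cases
    case 1
    have "(w x - w y)\<^sup>2 = (w y - w x)\<^sup>2" "(x - y) * (\<phi> x - \<phi> y) = (y - x) * (\<phi> y - \<phi> x)"
      by (simp_all add: power2_commute algebra_simps)
    then show ?thesis using main[OF 1] by simp
  next
    case 2
    then show ?thesis using main[OF 2] by simp
  qed
qed

text \<open>The admissible nonlinearities of the test functions: the Lipschitz bound keeps \<phi>
  \<circ> u in the energy space, monotonicity gives both fractional forms a sign, and vanishing on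
  the negative axis makes \<phi> nonnegative and \<phi> \<circ> u zero outside \<Omega>.\<close>

definition profile :: "(real \<Rightarrow> real) \<Rightarrow> real \<Rightarrow> bool" where
  "profile \<phi> L \<longleftrightarrow> mono \<phi> \<and> (\<forall>\<tau>\<le>0. \<phi> \<tau> = 0) \<and> (\<forall>x y. \<bar>\<phi> x - \<phi> y\<bar> \<le> L * \<bar>x - y\<bar>)"

lemma profileD:
  assumes "profile \<phi> L"
  shows "mono \<phi>" "\<tau> \<le> 0 \<Longrightarrow> \<phi> \<tau> = 0" "\<bar>\<phi> x - \<phi> y\<bar> \<le> L * \<bar>x - y\<bar>"
    "0 \<le> \<phi> \<tau>" "0 \<le> L" "0 \<le> (x - y) * (\<phi> x - \<phi> y)" "\<phi> \<in> borel_measurable borel"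
proof -
  show m: "mono \<phi>" and z: "\<tau> \<le> 0 \<Longrightarrow> \<phi> \<tau> = 0" and l: "\<bar>\<phi> x - \<phi> y\<bar> \<le> L * \<bar>x - y\<bar>" for x y \<tau>
    using assms by (auto simp: profile_def)
  show "0 \<le> \<phi> \<tau>" using monoD[OF m, of 0 \<tau>] z[of \<tau>] z[of 0] by linarith
  show "0 \<le> L" using l[of 1 0] by simp
  show "0 \<le> (x - y) * (\<phi> x - \<phi> y)"
    using monoD[OF m, of x y] monoD[OF m, of y x]
    by (cases "x \<le> y") (auto intro: mult_nonpos_nonpos mult_nonneg_nonneg)
  show "\<phi> \<in> borel_measurable borel" by (rule borel_measurable_mono[OF m])
qed

lemma profile_shifted_positive_part:
  fixes k :: real
  defines "\<phi> \<equiv> \<lambda>\<tau>. max (\<tau> - k) 0"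
  assumes "0 \<le> k"
  shows "profile \<phi> 1" "(\<phi> x - \<phi> y)\<^sup>2 \<le> 1 * ((x - y) * (\<phi> x - \<phi> y))"
proof -
  show "profile \<phi> 1" using assms by (auto simp: profile_def mono_def max_def)
  have "0 \<le> (x - y - (\<phi> x - \<phi> y)) * (\<phi> x - \<phi> y)"
    by (cases "x \<le> y") (auto simp: \<phi>_def max_def intro: mult_nonneg_nonneg mult_nonpos_nonpos mult_nonpos_nonneg)
  then show "(\<phi> x - \<phi> y)\<^sup>2 \<le> 1 * ((x - y) * (\<phi> x - \<phi> y))" by (simp add: power2_eq_square algebra_simps)
qed

text \<open>\<open>P\<close> is the Sobolev exponent, \<open>R\<close> the upper critical Choquard exponent, and \<open>t\<close> the
  diagonal Hardy--Littlewood--Sobolev exponent; the condition \<open>\<mu> < 4 s\<^sub>1\<close> says exactly \<open>2 < R\<close>.\<close>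

locale choquard_solution =
  fixes \<Omega> :: "'a::euclidean_space set" and u a :: "'a \<Rightarrow> real"
    and s1 s2 p q r \<mu> \<beta> lam a0 n P R t :: real
  assumes n: "n = real DIM('a)"
    and P: "P = 2 * n / (n - 2 * s1)"
    and R: "R = (2 * n - \<mu>) / (n - 2 * s1)"
    and t: "t = 2 * n / (2 * n - \<mu>)"
    and \<Omega>: "open \<Omega>" "bounded \<Omega>" "\<Omega> \<noteq> {}"
    and s: "0 < s1" "2 * s1 < n"
    and \<mu>: "0 < \<mu>" "\<mu> < n" "\<mu> < 4 * s1"
    and q: "1 < q" "q < 2"
    and r: "1 < r" "r \<le> R"
    and params: "0 \<le> lam" "0 \<le> \<beta>"
    and a: "0 \<le> a0" "AE x in lebesgue. x \<in> \<Omega> \<longrightarrow> \<bar>a x\<bar> \<le> a0"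
    and sol: "is_solution \<Omega> s1 s2 p q r \<mu> a \<beta> lam u"
begin

lemma exponents: "0 < n" "2 < P" "2 < R" "0 < t" "1 < t" "1 / t = R / P" "R * t = P"
proof -
  show "0 < n" by (simp add: n)
  then show "2 < P" "2 < R" "0 < t" "1 < t" "1 / t = R / P"
    using s \<mu> by (auto simp: P R t field_simps)
  show "R * t = P" using s \<mu> by (simp add: P R t)
qed

lemma \<Omega>_lmeasurable: "\<Omega> \<in> lmeasurable"
  using \<Omega> by (intro lmeasurable_open)

lemma \<Omega>_sets [measurable]: "\<Omega> \<in> sets lebesgue"
  using \<Omega>_lmeasurable by (rule fmeasurableD)

lemma u_measurable [measurable]: "u \<in> borel_measurable lebesgue"
  using sol by (simp add: is_solution_def frac_space_def Lp_def)

lemma cross_region_sets [measurable]: "cross_region \<Omega> \<in> sets (lebesgue \<Otimes>\<^sub>M lebesgue)"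
proof -
  have "- \<Omega> \<in> sets lebesgue" using sets.compl_sets[OF \<Omega>_sets] by (simp add: Compl_eq_Diff_UNIV)
  then have "(- \<Omega>) \<times> (- \<Omega>) \<in> sets (lebesgue \<Otimes>\<^sub>M lebesgue)" by (intro pair_measureI)
  from sets.compl_sets[OF this] show ?thesis
    by (simp add: cross_region_def Compl_eq_Diff_UNIV space_pair_measure)
qed

definition source :: "'a \<Rightarrow> real" where
  "source y = indicator \<Omega> y * (1 + \<bar>u y\<bar> powr R)"

definition potential :: "'a \<Rightarrow> ennreal" where
  "potential x = (\<integral>\<^sup>+y. ennreal (source y * norm (x - y) powr - \<mu>) \<partial>lebesgue)"

lemma source_nonneg: "0 \<le> source y"
  by (simp add: source_def)

lemma source_measurable [measurable]: "source \<in> borel_measurable lebesgue"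
  unfolding source_def by measurable

lemma potential_measurable [measurable]: "potential \<in> borel_measurable lebesgue"
  unfolding potential_def by measurable

text \<open>This converts the term with \<open>a\<close> into a nonlocal one: a constant factor on
  \<Omega> is at most a multiple of the potential. Distances within \<Omega> are bounded, so the
  kernel has a positive lower bound there.\<close>

lemma potential_ge: "\<exists>c>0. \<forall>x\<in>\<Omega>. ennreal c \<le> potential x"
proof -
  obtain d where d: "d > 0" "\<And>x. x \<in> \<Omega> \<Longrightarrow> norm x \<le> d"
    using \<Omega>(2) by (auto simp: bounded_pos)
  define c where "c = (2 * d) powr - \<mu> * measure lebesgue \<Omega>"
  have "emeasure lebesgue \<Omega> \<noteq> 0"
    using \<Omega> open_not_negligible[of \<Omega>] by (auto simp: negligible_iff_null_sets null_sets_def)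
  moreover have em: "emeasure lebesgue \<Omega> = ennreal (measure lebesgue \<Omega>)"
    using \<Omega>_lmeasurable by (rule emeasure_eq_measure2)
  ultimately have "0 < c" using d by (auto simp: c_def zero_less_measure_iff)
  moreover have "ennreal c \<le> potential x" if x: "x \<in> \<Omega>" for x
  proof -
    have "ennreal c = (\<integral>\<^sup>+y. ennreal ((2 * d) powr - \<mu>) * indicator \<Omega> y \<partial>lebesgue)"
      by (simp add: c_def nn_integral_cmult em ennreal_mult)
    also have "\<dots> \<le> potential x"
      unfolding potential_def
    proof (rule nn_integral_mono_AE)
      \<comment> \<open>At \<open>y = x\<close> the kernel has the value 0 by the convention for
        \<open>powr\<close>, and the lower bound fails there.\<close>
      have "AE y in lebesgue. y \<noteq> x"
        by (rule AE_I[of _ _ "{x}"]) auto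
      then show "AE y in lebesgue. ennreal ((2 * d) powr - \<mu>) * indicator \<Omega> y
          \<le> ennreal (source y * norm (x - y) powr - \<mu>)"
      proof eventually_elim
        case (elim y)
        show ?case
        proof (cases "y \<in> \<Omega>")
          case True
          have "norm (x - y) \<le> 2 * d" using norm_triangle_ineq4[of x y] d(2)[OF x] d(2)[OF True] by linarith
          then have "(2 * d) powr - \<mu> \<le> norm (x - y) powr - \<mu>"
            using elim \<mu> by (intro powr_mono2') auto
          also have "\<dots> \<le> source y * norm (x - y) powr - \<mu>"
            using True by (simp add: source_def mult_le_cancel_right1)
          finally show ?thesis using True by (simp add: ennreal_leI)
        qed simp
      qed
    qed
    finally show ?thesis .
  qed
  ultimately show ?thesis by blast
qed

lemma test_function:
  assumes "profile \<phi> L"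
  shows "(\<lambda>x. \<phi> (u x)) \<in> frac_space \<Omega> s1 2"
proof -
  have u: "integrable lebesgue (\<lambda>x. \<bar>u x\<bar> powr 2)" "AE x in lebesgue. x \<notin> \<Omega> \<longrightarrow> u x = 0"
    "integrable (lebesgue \<Otimes>\<^sub>M lebesgue) (\<lambda>p. indicator (cross_region \<Omega>) p *\<^sub>R
      (case p of (x, y) \<Rightarrow> \<bar>u x - u y\<bar> powr 2 / norm (x - y) powr (real DIM('a) + 2 * s1)))"
    using sol by (auto simp: is_solution_def frac_space_def Lp_def set_integrable_def)
  note \<phi> = profileD[OF assms]
  note L = \<phi>(5) and [measurable] = \<phi>(7)
  have sq: "\<bar>\<phi> x - \<phi> y\<bar> powr 2 \<le> L powr 2 * \<bar>x - y\<bar> powr 2" for x y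
    using powr_mono2[OF _ _ \<phi>(3)[of x y], of 2] L by (simp add: powr_mult)
  have "integrable lebesgue (\<lambda>x. \<bar>\<phi> (u x)\<bar> powr 2)"
    using sq[of _ 0] \<phi>(2)[of 0]
    by (intro Bochner_Integration.integrable_bound[OF integrable_mult_right[OF u(1), of "L powr 2"]]) auto
  moreover have "AE x in lebesgue. x \<notin> \<Omega> \<longrightarrow> \<phi> (u x) = 0"
    using u(2) by eventually_elim (simp add: \<phi>(2))
  moreover have "set_integrable (lebesgue \<Otimes>\<^sub>M lebesgue) (cross_region \<Omega>)
      (\<lambda>(x, y). \<bar>\<phi> (u x) - \<phi> (u y)\<bar> powr 2 / norm (x - y) powr (real DIM('a) + 2 * s1))"
    unfolding set_integrable_def
  proof (rule Bochner_Integration.integrable_bound[OF integrable_mult_right[OF u(3), of "L powr 2"]])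
    show "(\<lambda>p. indicator (cross_region \<Omega>) p *\<^sub>R (case p of (x, y) \<Rightarrow>
        \<bar>\<phi> (u x) - \<phi> (u y)\<bar> powr 2 / norm (x - y) powr (real DIM('a) + 2 * s1)))
        \<in> borel_measurable (lebesgue \<Otimes>\<^sub>M lebesgue)"
      by measurable
    show "AE p in lebesgue \<Otimes>\<^sub>M lebesgue. norm (indicator (cross_region \<Omega>) p *\<^sub>R (case p of (x, y) \<Rightarrow>
        \<bar>\<phi> (u x) - \<phi> (u y)\<bar> powr 2 / norm (x - y) powr (real DIM('a) + 2 * s1)))
        \<le> norm (L powr 2 * indicator (cross_region \<Omega>) p *\<^sub>R (case p of (x, y) \<Rightarrow>
        \<bar>u x - u y\<bar> powr 2 / norm (x - y) powr (real DIM('a) + 2 * s1)))"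
      using sq by (intro AE_I2) (auto simp: indicator_def divide_right_mono)
  qed
  ultimately show ?thesis by (simp add: frac_space_def Lp_def)
qed

end

section \<open>The energy inequality\<close>

lemma ennreal_add_le: "ennreal (x + y) \<le> ennreal x + ennreal y"
proof -
  have "ennreal (x + y) \<le> ennreal (max 0 x + max 0 y)" by (intro ennreal_leI) simp
  then show ?thesis by (cases "0 \<le> x"; cases "0 \<le> y") (auto simp: max_def ennreal_neg)
qed

context choquard_solution begin

text \<open>Using \<open>max 1 (u x)\<close> instead of \<open>u x\<close> gives one weight that
  dominates the local factors of both reaction terms, whose exponents \<open>q\<close> and
  \<open>r\<close> lie between 1 and \<open>R\<close>.\<close>

definition weighted :: "(real \<Rightarrow> real) \<Rightarrow> 'a \<Rightarrow> real" where
  "weighted \<phi> x = indicator \<Omega> x * (max 1 (u x) powr (R - 1) * \<phi> (u x))"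

lemma reaction_le:
  assumes profile: "profile \<phi> L" and e: "1 < e" "e \<le> R"
  shows "signed_pow e (u x) * \<phi> (u x) \<le> max 1 (u x) powr (R - 1) * \<phi> (u x)"
    and "0 \<le> signed_pow e (u x) * \<phi> (u x)"
proof -
  have "signed_pow e (u x) * \<phi> (u x) \<le> max 1 (u x) powr (R - 1) * \<phi> (u x) \<and> 0 \<le> signed_pow e (u x) * \<phi> (u x)"
  proof (cases "0 < u x")
    case True
    then have "signed_pow e (u x) = u x powr (e - 1)"
      using powr_add[of "u x" "e - 2" 1] by (simp add: signed_pow_def)
    moreover have "u x powr (e - 1) \<le> max 1 (u x) powr (e - 1)"
      using True e by (intro powr_mono2) auto
    moreover have "max 1 (u x) powr (e - 1) \<le> max 1 (u x) powr (R - 1)"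
      using e by (intro powr_mono) auto
    ultimately show ?thesis using profileD(4)[OF profile] by (auto intro!: mult_right_mono)
  qed (simp add: profileD(2)[OF profile])
  then show "signed_pow e (u x) * \<phi> (u x) \<le> max 1 (u x) powr (R - 1) * \<phi> (u x)"
    "0 \<le> signed_pow e (u x) * \<phi> (u x)" by auto
qed

lemma form_le:
  "\<exists>c\<ge>0. \<forall>\<phi> L. profile \<phi> L \<longrightarrow>
    ennreal (frac_form \<Omega> s1 2 u (\<lambda>x. \<phi> (u x))) \<le> ennreal c * (\<integral>\<^sup>+x. potential x * ennreal (weighted \<phi> x) \<partial>lebesgue)"
proof -
  obtain c0 where c0: "0 < c0" "\<forall>x\<in>\<Omega>. ennreal c0 \<le> potential x"
    using potential_ge by auto
  \<comment> \<open>The quotient pays for the term with \<open>a\<close>, by writing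
    \<open>a0\<close> as \<open>a0 / c0 * c0\<close> and bounding \<open>c0\<close> by the
    potential; the 1 pays for the Choquard term. Nothing depends on \<phi>.\<close>
  define c where "c = lam * a0 / c0 + 1"
  have c: "0 \<le> lam * a0 / c0" using c0 params a by simp
  show ?thesis
  proof (intro exI[of _ c] conjI allI impI)
    show "0 \<le> c" using c by (simp add: c_def)
    fix \<phi> :: "real \<Rightarrow> real" and L
    assume profile: "profile \<phi> L"
    note \<phi> = profileD[OF profile]
    note \<phi>0 = \<phi>(4) and [measurable] = \<phi>(7)
    have [measurable]: "weighted \<phi> \<in> borel_measurable lebesgue" unfolding weighted_def by measurable
    have [measurable]: "(\<lambda>z. weighted \<phi> (fst z)) \<in> borel_measurable (lebesgue \<Otimes>\<^sub>M lebesgue)"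
      "(\<lambda>z. source (snd z)) \<in> borel_measurable (lebesgue \<Otimes>\<^sub>M lebesgue)"
      "(\<lambda>z. norm (fst z - snd z) powr - \<mu>) \<in> borel_measurable (lebesgue \<Otimes>\<^sub>M (lebesgue :: 'a measure))"
      by measurable
    have meas: "(\<lambda>(x, y). ennreal (source y * norm (x - y) powr - \<mu>) * ennreal (weighted \<phi> x))
        \<in> borel_measurable (lebesgue \<Otimes>\<^sub>M lebesgue)"
      unfolding split_beta by measurable
    have W0: "0 \<le> weighted \<phi> x" for x using \<phi>0 by (simp add: weighted_def)
    let ?v = "\<lambda>x. \<phi> (u x)"
    let ?J = "\<integral>\<^sup>+x. potential x * ennreal (weighted \<phi> x) \<partial>lebesgue"
    let ?I = "set_lebesgue_integral lebesgue \<Omega> (\<lambda>x. a x * signed_pow q (u x) * ?v x)"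
    have eq: "frac_form \<Omega> s1 2 u ?v + \<beta> * frac_form \<Omega> s2 p u ?v - lam * ?I - choquard_form \<Omega> \<mu> r u ?v = 0"
      using sol test_function[OF profile] by (auto simp: is_solution_def)
    \<comment> \<open>The integrand is a nonnegative power times the product of the increments of
      \<open>u\<close> and \<phi> \<circ> u, which have the same sign; if it were not integrable,
      the integral would be 0 and the claim would still hold.\<close>
    have "0 \<le> frac_form \<Omega> s2 p u ?v"
      unfolding frac_form_def set_lebesgue_integral_def
    proof (rule integral_nonneg_AE, rule AE_I2, clarify)
      fix x y
      have "0 \<le> signed_pow p (u x - u y) * (\<phi> (u x) - \<phi> (u y))"
        using \<phi>(6) by (simp add: signed_pow_def mult.assoc)
      then show "0 \<le> indicator (cross_region \<Omega>) (x, y) *\<^sub>R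
          (signed_pow p (u x - u y) * (\<phi> (u x) - \<phi> (u y)) / norm (x - y) powr (real DIM('a) + p * s2))"
        by simp
    qed
    then have "frac_form \<Omega> s1 2 u ?v \<le> lam * ?I + choquard_form \<Omega> \<mu> r u ?v"
      using eq params mult_nonneg_nonneg[of \<beta> "frac_form \<Omega> s2 p u ?v"] by linarith
    then have "ennreal (frac_form \<Omega> s1 2 u ?v) \<le> ennreal (lam * ?I + choquard_form \<Omega> \<mu> r u ?v)"
      by (rule ennreal_leI)
    also have "\<dots> \<le> ennreal (lam * ?I) + ennreal (choquard_form \<Omega> \<mu> r u ?v)"
      by (rule ennreal_add_le)
    also have "ennreal (lam * ?I) \<le> ennreal (lam * a0 / c0) * ?J"
    proof -
      have "ennreal ?I \<le> (\<integral>\<^sup>+x. ennreal (indicator \<Omega> x *\<^sub>R (a x * signed_pow q (u x) * ?v x)) \<partial>lebesgue)"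
        unfolding set_lebesgue_integral_def by (rule ennreal_integral_le)
      also have "\<dots> \<le> (\<integral>\<^sup>+x. ennreal (a0 / c0) * (potential x * ennreal (weighted \<phi> x)) \<partial>lebesgue)"
      proof (rule nn_integral_mono_AE)
        show "AE x in lebesgue. ennreal (indicator \<Omega> x *\<^sub>R (a x * signed_pow q (u x) * ?v x))
            \<le> ennreal (a0 / c0) * (potential x * ennreal (weighted \<phi> x))"
          using a(2)
        proof eventually_elim
          case (elim x)
          show ?case
          proof (cases "x \<in> \<Omega>")
            case True
            have "a x * (signed_pow q (u x) * ?v x) \<le> a0 * (max 1 (u x) powr (R - 1) * ?v x)"
              using elim True a(1) reaction_le[OF profile, where e = q] q exponents
              by (intro mult_mono[of "a x"]) auto
            also have "\<dots> = a0 / c0 * (c0 * weighted \<phi> x)" using True c0 by (simp add: weighted_def)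
            finally have "ennreal (indicator \<Omega> x *\<^sub>R (a x * signed_pow q (u x) * ?v x))
                \<le> ennreal (a0 / c0 * (c0 * weighted \<phi> x))"
              using True by (simp add: mult.assoc ennreal_leI)
            also have "\<dots> = ennreal (a0 / c0) * (ennreal c0 * ennreal (weighted \<phi> x))"
              using a(1) c0(1) W0[of x] by (simp flip: ennreal_mult)
            also have "\<dots> \<le> ennreal (a0 / c0) * (potential x * ennreal (weighted \<phi> x))"
              using c0(2) True by (intro mult_left_mono mult_right_mono) auto
            finally show ?thesis .
          qed simp
        qed
      qed
      also have "\<dots> = ennreal (a0 / c0) * ?J" by (intro nn_integral_cmult) measurable
      finally have "ennreal lam * ennreal ?I \<le> ennreal lam * (ennreal (a0 / c0) * ?J)"
        by (rule mult_left_mono) simp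
      then show ?thesis using params(1) a(1) c0(1)
        by (simp add: ennreal_mult' mult.assoc[symmetric] flip: ennreal_mult)
    qed
    also have "ennreal (choquard_form \<Omega> \<mu> r u ?v) \<le> ?J"
    proof -
      have "ennreal (choquard_form \<Omega> \<mu> r u ?v) \<le> (\<integral>\<^sup>+z. ennreal (indicator (\<Omega> \<times> \<Omega>) z *\<^sub>R
          (case z of (x, y) \<Rightarrow> \<bar>u y\<bar> powr r * signed_pow r (u x) * ?v x / norm (x - y) powr \<mu>)) \<partial>(lebesgue \<Otimes>\<^sub>M lebesgue))"
        unfolding choquard_form_def set_lebesgue_integral_def by (rule ennreal_integral_le)
      also have "\<dots> \<le> (\<integral>\<^sup>+z. (case z of (x, y) \<Rightarrow> ennreal (source y * norm (x - y) powr - \<mu>) * ennreal (weighted \<phi> x)) \<partial>(lebesgue \<Otimes>\<^sub>M lebesgue))"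
      proof (intro nn_integral_mono, clarify)
        fix x y
        show "ennreal (indicator (\<Omega> \<times> \<Omega>) (x, y) *\<^sub>R (\<bar>u y\<bar> powr r * signed_pow r (u x) * ?v x / norm (x - y) powr \<mu>))
          \<le> ennreal (source y * norm (x - y) powr - \<mu>) * ennreal (weighted \<phi> x)"
        proof (cases "x \<in> \<Omega> \<and> y \<in> \<Omega>")
          case True
          have "\<bar>u y\<bar> powr r \<le> 1 + \<bar>u y\<bar> powr R"
          proof (cases "\<bar>u y\<bar> \<le> 1")
            case True
            then have "\<bar>u y\<bar> powr r \<le> 1" using r by (intro powr_le1) auto
            then show ?thesis by (simp add: add_increasing2)
          next
            case False
            then show ?thesis using r powr_mono[of r R "\<bar>u y\<bar>"] by linarith
          qed
          then have "\<bar>u y\<bar> powr r \<le> source y" using True by (simp add: source_def)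
          then have "\<bar>u y\<bar> powr r * (signed_pow r (u x) * ?v x) \<le> source y * (max 1 (u x) powr (R - 1) * ?v x)"
            using reaction_le[OF profile, where e = r] r source_nonneg
            by (intro mult_mono[of "\<bar>u y\<bar> powr r"]) auto
          then have "\<bar>u y\<bar> powr r * (signed_pow r (u x) * ?v x) * norm (x - y) powr - \<mu>
              \<le> source y * (max 1 (u x) powr (R - 1) * ?v x) * norm (x - y) powr - \<mu>"
            by (rule mult_right_mono) simp
          then have "ennreal (indicator (\<Omega> \<times> \<Omega>) (x, y) *\<^sub>R (\<bar>u y\<bar> powr r * signed_pow r (u x) * ?v x / norm (x - y) powr \<mu>))
              \<le> ennreal (source y * norm (x - y) powr - \<mu> * weighted \<phi> x)"
            using True by (intro ennreal_leI) (simp add: weighted_def powr_minus_divide mult_ac)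
          also have "\<dots> = ennreal (source y * norm (x - y) powr - \<mu>) * ennreal (weighted \<phi> x)"
            using source_nonneg W0 by (intro ennreal_mult) auto
          finally show ?thesis .
        qed auto
      qed
      also have "\<dots> = (\<integral>\<^sup>+x. \<integral>\<^sup>+y. ennreal (source y * norm (x - y) powr - \<mu>) * ennreal (weighted \<phi> x) \<partial>lebesgue \<partial>lebesgue)"
        using lebesgue.nn_integral_fst[OF meas] by simp
      also have "\<dots> = ?J"
        unfolding potential_def by (intro nn_integral_cong nn_integral_multc) measurable
      finally show ?thesis .
    qed
    also have "ennreal (lam * a0 / c0) * ?J + ?J = ennreal c * ?J"
      using c by (simp add: c_def distrib_right)
    finally show "ennreal (frac_form \<Omega> s1 2 u ?v) \<le> ennreal c * ?J"
      by (simp add: add_mono)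
  qed
qed

text \<open>For \<open>x\<close> in \<Omega> every pair \<open>(x, y)\<close> belongs to the cross
  region, and the integrand is nonnegative, so enlarging the domain only helps. Integrability, from
  the Lipschitz bound, is essential here: it identifies the form with a genuine nonnegative
  integral.\<close>

lemma form_ge:
  assumes profile: "profile \<phi> L"
    and [measurable]: "w \<in> borel_measurable borel"
    and w: "\<And>x y. (w x - w y)\<^sup>2 \<le> K * ((x - y) * (\<phi> x - \<phi> y))" and K: "0 \<le> K"
  shows "(\<integral>\<^sup>+x. indicator \<Omega> x * (\<integral>\<^sup>+y. ennreal (\<bar>w (u x) - w (u y)\<bar> powr 2 * norm (x - y) powr - (n + 2 * s1)) \<partial>lebesgue) \<partial>lebesgue)
    \<le> ennreal K * ennreal (frac_form \<Omega> s1 2 u (\<lambda>x. \<phi> (u x)))"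
proof -
  note \<phi> = profileD[OF profile]
  note L = \<phi>(5) and \<phi>0 = \<phi>(6) and [measurable] = \<phi>(7)
  let ?k = "\<lambda>z. indicator (cross_region \<Omega>) z *\<^sub>R (case z of (x, y) \<Rightarrow>
      signed_pow 2 (u x - u y) * (\<phi> (u x) - \<phi> (u y)) / norm (x - y) powr (real DIM('a) + 2 * s1))"
  have sp: "signed_pow 2 \<tau> = \<tau>" for \<tau> by (simp add: signed_pow_def)
  have k: "?k (x, y) = indicator (cross_region \<Omega>) (x, y) * ((u x - u y) * (\<phi> (u x) - \<phi> (u y)) * norm (x - y) powr - (n + 2 * s1))" for x y
    by (simp only: powr_minus_divide n[symmetric]) (simp add: sp)
  have k0: "0 \<le> ?k z" for z
    using \<phi>0 by (cases z) (simp add: sp)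
  have "integrable (lebesgue \<Otimes>\<^sub>M lebesgue) (\<lambda>z. indicator (cross_region \<Omega>) z *\<^sub>R
      (case z of (x, y) \<Rightarrow> \<bar>u x - u y\<bar> powr 2 / norm (x - y) powr (real DIM('a) + 2 * s1)))"
    using sol by (auto simp: is_solution_def frac_space_def set_integrable_def)
  then have int: "integrable (lebesgue \<Otimes>\<^sub>M lebesgue) ?k"
  proof (rule Bochner_Integration.integrable_bound[OF integrable_mult_right[where c = L]])
    show "?k \<in> borel_measurable (lebesgue \<Otimes>\<^sub>M lebesgue)" unfolding sp by measurable
    have "\<bar>(x - y) * (\<phi> x - \<phi> y)\<bar> \<le> L * \<bar>x - y\<bar> powr 2" for x y
      using mult_left_mono[OF \<phi>(3)[of x y], of "\<bar>x - y\<bar>"]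
      by (simp add: abs_mult mult_ac power2_eq_square)
    then have "\<bar>(x - y) * (\<phi> x - \<phi> y)\<bar> / N \<le> L * \<bar>x - y\<bar> powr 2 / N" if "0 \<le> N" for x y N
      using that by (rule divide_right_mono)
    from this[of "norm (_ - _) powr _"]
    show "AE z in lebesgue \<Otimes>\<^sub>M lebesgue. norm (?k z) \<le> norm (L * (indicator (cross_region \<Omega>) z *\<^sub>R
      (case z of (x, y) \<Rightarrow> \<bar>u x - u y\<bar> powr 2 / norm (x - y) powr (real DIM('a) + 2 * s1))))"
      using L by (intro AE_I2) (auto simp: sp indicator_def abs_mult)
  qed
  have meas: "(\<lambda>z. ennreal (?k z)) \<in> borel_measurable (lebesgue \<Otimes>\<^sub>M lebesgue)"
    by (rule measurable_compose[OF borel_measurable_integrable[OF int] measurable_ennreal])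
  have "(\<integral>\<^sup>+x. indicator \<Omega> x * (\<integral>\<^sup>+y. ennreal (\<bar>w (u x) - w (u y)\<bar> powr 2 * norm (x - y) powr - (n + 2 * s1)) \<partial>lebesgue) \<partial>lebesgue)
      = (\<integral>\<^sup>+x. \<integral>\<^sup>+y. indicator \<Omega> x * ennreal (\<bar>w (u x) - w (u y)\<bar> powr 2 * norm (x - y) powr - (n + 2 * s1)) \<partial>lebesgue \<partial>lebesgue)"
    by (intro nn_integral_cong nn_integral_cmult[symmetric]) measurable
  also have "\<dots> \<le> (\<integral>\<^sup>+x. \<integral>\<^sup>+y. ennreal K * ennreal (?k (x, y)) \<partial>lebesgue \<partial>lebesgue)"
  proof (intro nn_integral_mono)
    fix x y
    show "indicator \<Omega> x * ennreal (\<bar>w (u x) - w (u y)\<bar> powr 2 * norm (x - y) powr - (n + 2 * s1))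
        \<le> ennreal K * ennreal (?k (x, y))"
    proof (cases "x \<in> \<Omega>")
      case True
      then have in_cross: "(x, y) \<in> cross_region \<Omega>" by (simp add: cross_region_def)
      let ?X = "(u x - u y) * (\<phi> (u x) - \<phi> (u y)) * norm (x - y) powr - (n + 2 * s1)"
      have "\<bar>w (u x) - w (u y)\<bar> powr 2 * norm (x - y) powr - (n + 2 * s1) \<le> K * ?X"
        using mult_right_mono[OF w[of "u x" "u y"], of "norm (x - y) powr - (n + 2 * s1)"] by (simp add: mult.assoc)
      then have "ennreal (\<bar>w (u x) - w (u y)\<bar> powr 2 * norm (x - y) powr - (n + 2 * s1)) \<le> ennreal (K * ?X)"
        by (rule ennreal_leI)
      also have "ennreal (K * ?X) = ennreal K * ennreal ?X"
        using \<phi>0 by (intro ennreal_mult K) simp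
      finally show ?thesis unfolding k using True in_cross by simp
    qed simp
  qed
  also have "\<dots> = (\<integral>\<^sup>+z. ennreal K * ennreal (?k z) \<partial>(lebesgue \<Otimes>\<^sub>M lebesgue))"
    by (intro lebesgue.nn_integral_fst borel_measurable_times_ennreal borel_measurable_const meas)
  also have "\<dots> = ennreal K * ennreal (frac_form \<Omega> s1 2 u (\<lambda>x. \<phi> (u x)))"
    unfolding frac_form_def set_lebesgue_integral_def
    by (simp only: nn_integral_cmult[OF meas] nn_integral_eq_integral[OF int AE_I2[OF k0]])
  finally show ?thesis .
qed

text \<open>The constant \<open>S\<close> is fixed before \<phi>, \<open>w\<close>, \<open>K\<close>
  and \<open>D\<close>, so the same constant serves all truncation heights and all levels.\<close>

lemma energy:
  "\<exists>S\<ge>0. \<forall>\<phi> L w K D. profile \<phi> L \<longrightarrow> w \<in> borel_measurable borel \<longrightarrow> w 0 = 0 \<longrightarrow> 0 \<le> K \<longrightarrow>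
    (\<forall>x y. (w x - w y)\<^sup>2 \<le> K * ((x - y) * (\<phi> x - \<phi> y))) \<longrightarrow> 0 \<le> D \<longrightarrow>
    (\<integral>\<^sup>+x. potential x * ennreal (weighted \<phi> x) \<partial>lebesgue) \<le> ennreal D \<longrightarrow>
    (\<integral>\<^sup>+x. ennreal (\<bar>w (u x)\<bar> powr P) \<partial>lebesgue) \<le> ennreal (S * (K * D) powr (P / 2))"
proof -
  obtain c where c: "0 \<le> c" "\<forall>\<phi> L. profile \<phi> L \<longrightarrow>
    ennreal (frac_form \<Omega> s1 2 u (\<lambda>x. \<phi> (u x))) \<le> ennreal c * (\<integral>\<^sup>+x. potential x * ennreal (weighted \<phi> x) \<partial>lebesgue)"
    using form_le by auto
  obtain S where S: "0 \<le> S" "\<forall>\<Omega> v D. v \<in> borel_measurable lebesgue \<longrightarrow> \<Omega> \<in> lmeasurable \<longrightarrow>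
      (AE x in lebesgue. x \<notin> \<Omega> \<longrightarrow> v x = 0) \<longrightarrow> 0 \<le> D \<longrightarrow>
      (\<integral>\<^sup>+x. indicator \<Omega> x * (\<integral>\<^sup>+y. ennreal (\<bar>v x - v y\<bar> powr 2 * norm (x - y) powr - (n + 2 * s1)) \<partial>lebesgue) \<partial>lebesgue)
        \<le> ennreal D \<longrightarrow>
      (\<integral>\<^sup>+(x::'a). ennreal (\<bar>v x\<bar> powr P) \<partial>lebesgue) \<le> ennreal (S * D powr (P / 2))"
    using fractional_sobolev[where 'a = 'a and s = s1, folded n, folded P, OF s] by auto
  show ?thesis
  proof (intro exI[of _ "S * c powr (P / 2)"] conjI allI impI)
    show "0 \<le> S * c powr (P / 2)" using S by simp
    fix \<phi> w :: "real \<Rightarrow> real" and L K D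
    assume profile: "profile \<phi> L"
      and w [measurable]: "w \<in> borel_measurable borel" and w0: "w 0 = 0" and K: "0 \<le> K"
      and wK: "\<forall>x y. (w x - w y)\<^sup>2 \<le> K * ((x - y) * (\<phi> x - \<phi> y))" and D: "0 \<le> D"
      and J: "(\<integral>\<^sup>+x. potential x * ennreal (weighted \<phi> x) \<partial>lebesgue) \<le> ennreal D"
    have "AE x in lebesgue. x \<notin> \<Omega> \<longrightarrow> u x = 0"
      using sol by (auto simp: is_solution_def frac_space_def)
    then have zero: "AE x in lebesgue. x \<notin> \<Omega> \<longrightarrow> w (u x) = 0"
      by eventually_elim (simp add: w0)
    have "ennreal (frac_form \<Omega> s1 2 u (\<lambda>x. \<phi> (u x))) \<le> ennreal c * ennreal D"
      using c(2) profile mult_left_mono[OF J, of "ennreal c"] by (blast intro: order_trans zero_le)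
    then have "ennreal K * ennreal (frac_form \<Omega> s1 2 u (\<lambda>x. \<phi> (u x))) \<le> ennreal K * (ennreal c * ennreal D)"
      by (rule mult_left_mono) simp
    also have "\<dots> = ennreal (c * (K * D))"
      using c(1) K D by (simp add: mult_ac flip: ennreal_mult)
    finally have "(\<integral>\<^sup>+x. ennreal (\<bar>w (u x)\<bar> powr P) \<partial>lebesgue) \<le> ennreal (S * (c * (K * D)) powr (P / 2))"
      using c(1) K D zero \<Omega>_lmeasurable order_trans[OF form_ge[OF profile w wK[rule_format] K]]
      by (intro S(2)[rule_format, of _ \<Omega>]) auto
    then show "(\<integral>\<^sup>+x. ennreal (\<bar>w (u x)\<bar> powr P) \<partial>lebesgue) \<le> ennreal (S * c powr (P / 2) * (K * D) powr (P / 2))"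
      by (simp only: powr_mult mult.assoc)
  qed
qed

end

section \<open>Integrability of all powers\<close>

locale nonneg_choquard_solution = choquard_solution +
  assumes nonneg: "AE x in lebesgue. 0 \<le> u x"
begin

text \<open>The form with the positive part of \<open>u\<close> is a real number, so Sobolev's
  inequality applies to it directly. The inequality \<open>energy\<close> would require a finite
  reaction integral, which is itself deduced from the present lemma.\<close>

lemma u_integrable: "(\<integral>\<^sup>+x. ennreal (\<bar>u x\<bar> powr P) \<partial>lebesgue) < \<infinity>"
proof -
  define \<phi> where "\<phi> = (\<lambda>\<tau>::real. max (\<tau> - 0) 0)"
  have profile: "profile \<phi> 1" and sq: "(\<phi> x - \<phi> y)\<^sup>2 \<le> 1 * ((x - y) * (\<phi> x - \<phi> y))" for x y
    unfolding \<phi>_def by (rule profile_shifted_positive_part; simp)+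
  have [measurable]: "\<phi> \<in> borel_measurable borel" using profile by (rule profileD)
  define D where "D = frac_form \<Omega> s1 2 u (\<lambda>x. \<phi> (u x))"
  have D: "(\<integral>\<^sup>+x. indicator \<Omega> x * (\<integral>\<^sup>+y. ennreal (\<bar>\<phi> (u x) - \<phi> (u y)\<bar> powr 2 * norm (x - y) powr - (n + 2 * s1)) \<partial>lebesgue) \<partial>lebesgue)
      \<le> ennreal (max 0 D)"
    using form_ge[OF profile _ sq] by (auto simp: D_def max_def ennreal_neg)
  obtain S where S: "0 \<le> S" "\<forall>\<Omega> v D. v \<in> borel_measurable lebesgue \<longrightarrow> \<Omega> \<in> lmeasurable \<longrightarrow>
      (AE x in lebesgue. x \<notin> \<Omega> \<longrightarrow> v x = 0) \<longrightarrow> 0 \<le> D \<longrightarrow>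
      (\<integral>\<^sup>+x. indicator \<Omega> x * (\<integral>\<^sup>+y. ennreal (\<bar>v x - v y\<bar> powr 2 * norm (x - y) powr - (n + 2 * s1)) \<partial>lebesgue) \<partial>lebesgue)
        \<le> ennreal D \<longrightarrow>
      (\<integral>\<^sup>+(x::'a). ennreal (\<bar>v x\<bar> powr P) \<partial>lebesgue) \<le> ennreal (S * D powr (P / 2))"
    using fractional_sobolev[where 'a = 'a and s = s1, folded n, folded P, OF s] by auto
  have "AE x in lebesgue. x \<notin> \<Omega> \<longrightarrow> u x = 0"
    using sol by (auto simp: is_solution_def frac_space_def)
  then have "AE x in lebesgue. x \<notin> \<Omega> \<longrightarrow> \<phi> (u x) = 0"
    by eventually_elim (simp add: \<phi>_def)
  then have "(\<integral>\<^sup>+x. ennreal (\<bar>\<phi> (u x)\<bar> powr P) \<partial>lebesgue) \<le> ennreal (S * max 0 D powr (P / 2))"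
    using D \<Omega>_lmeasurable by (intro S(2)[rule_format, of _ \<Omega>]) auto
  moreover have "(\<integral>\<^sup>+x. ennreal (\<bar>u x\<bar> powr P) \<partial>lebesgue) = (\<integral>\<^sup>+x. ennreal (\<bar>\<phi> (u x)\<bar> powr P) \<partial>lebesgue)"
    using nonneg by (intro nn_integral_cong_AE) (auto elim!: eventually_mono simp: \<phi>_def)
  ultimately show ?thesis by (simp add: le_less_trans[OF _ ennreal_less_top])
qed

text \<open>Since \<open>R * t = P\<close>, the source lies in \<open>L^t\<close>: this is the sense
  in which \<open>R\<close> is critical for the pairing. The norm of the source is absorbed into
  \<open>H\<close>, leaving only the dependence on \<open>g\<close>.\<close>

lemma potential_pairing:
  "\<exists>H\<ge>0. \<forall>(g :: 'a \<Rightarrow> real) B. g \<in> borel_measurable lebesgue \<longrightarrow> (\<forall>x. 0 \<le> g x) \<longrightarrow> 0 \<le> B \<longrightarrow>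
    (\<integral>\<^sup>+x. ennreal (g x powr t) \<partial>lebesgue) \<le> ennreal B \<longrightarrow>
    (\<integral>\<^sup>+x. potential x * ennreal (g x) \<partial>lebesgue) \<le> ennreal (H * B powr (1 / t))"
proof -
  obtain C where C: "C \<ge> 0" "\<forall>(f :: 'a \<Rightarrow> real) g A B. f \<in> borel_measurable lebesgue \<longrightarrow> g \<in> borel_measurable lebesgue \<longrightarrow>
      (\<forall>x. 0 \<le> f x) \<longrightarrow> (\<forall>x. 0 \<le> g x) \<longrightarrow> 0 \<le> A \<longrightarrow> 0 \<le> B \<longrightarrow>
      (\<integral>\<^sup>+x. ennreal (f x powr t) \<partial>lebesgue) \<le> ennreal A \<longrightarrow>
      (\<integral>\<^sup>+x. ennreal (g x powr t) \<partial>lebesgue) \<le> ennreal B \<longrightarrow>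
      (\<integral>\<^sup>+x. \<integral>\<^sup>+y. ennreal (f x * g y * norm (x - y) powr - \<mu>) \<partial>lebesgue \<partial>lebesgue)
        \<le> ennreal (C * (A powr (1 / t) * B powr (1 / t)))"
    using hardy_littlewood_sobolev[where 'a = 'a and \<mu> = \<mu>, folded n, folded t] \<mu> by auto
  have "(\<integral>\<^sup>+x. ennreal (source x powr t) \<partial>lebesgue)
      \<le> (\<integral>\<^sup>+x. ennreal (2 powr t) * indicator \<Omega> x + ennreal (2 powr t) * ennreal (\<bar>u x\<bar> powr P) \<partial>lebesgue)"
  proof (rule nn_integral_mono)
    fix x
    show "ennreal (source x powr t) \<le> ennreal (2 powr t) * indicator \<Omega> x + ennreal (2 powr t) * ennreal (\<bar>u x\<bar> powr P)"
    proof (cases "x \<in> \<Omega>")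
      case True
      have "(1 + \<bar>u x\<bar> powr R) powr t \<le> (2 * max 1 (\<bar>u x\<bar> powr R)) powr t"
        using exponents by (intro powr_mono2) auto
      also have "\<dots> = 2 powr t * max 1 (\<bar>u x\<bar> powr P)"
        using exponents by (simp add: powr_mult max_def powr_powr)
          (smt (verit) ge_one_powr_ge_zero powr_le1 powr_ge_zero powr_powr zero_less_mult_iff)
      also have "\<dots> \<le> 2 powr t * (1 + \<bar>u x\<bar> powr P)" by (intro mult_left_mono) auto
      finally show ?thesis
        using True by (simp add: source_def ennreal_leI distrib_left flip: ennreal_mult ennreal_plus)
    qed (simp add: source_def)
  qed
  also have "\<dots> = ennreal (2 powr t) * emeasure lebesgue \<Omega> + ennreal (2 powr t) * (\<integral>\<^sup>+x. ennreal (\<bar>u x\<bar> powr P) \<partial>lebesgue)"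
    by (simp add: nn_integral_add nn_integral_cmult)
  also have "\<dots> < \<infinity>"
    using u_integrable fmeasurableD2[OF \<Omega>_lmeasurable] by (simp add: ennreal_mult_less_top less_top)
  finally obtain A where A: "0 \<le> A" "(\<integral>\<^sup>+x. ennreal (source x powr t) \<partial>lebesgue) = ennreal A"
    by (cases "\<integral>\<^sup>+x. ennreal (source x powr t) \<partial>lebesgue") auto
  show ?thesis
  proof (intro exI[of _ "C * A powr (1 / t)"] conjI allI impI)
    show "0 \<le> C * A powr (1 / t)" using C by simp
    fix g :: "'a \<Rightarrow> real" and B :: real
    assume [measurable]: "g \<in> borel_measurable lebesgue" and g: "\<forall>x. 0 \<le> g x" and B: "0 \<le> B"
      "(\<integral>\<^sup>+x. ennreal (g x powr t) \<partial>lebesgue) \<le> ennreal B"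
    have "(\<integral>\<^sup>+x. potential x * ennreal (g x) \<partial>lebesgue)
        = (\<integral>\<^sup>+x. \<integral>\<^sup>+y. ennreal (source y * norm (x - y) powr - \<mu>) * ennreal (g x) \<partial>lebesgue \<partial>lebesgue)"
      unfolding potential_def by (intro nn_integral_cong nn_integral_multc[symmetric]) measurable
    also have "\<dots> = (\<integral>\<^sup>+x. \<integral>\<^sup>+y. ennreal (g x * source y * norm (x - y) powr - \<mu>) \<partial>lebesgue \<partial>lebesgue)"
      using g source_nonneg by (intro nn_integral_cong) (simp add: mult_ac flip: ennreal_mult)
    also have "\<dots> \<le> ennreal (C * (B powr (1 / t) * A powr (1 / t)))"
      using g B A source_nonneg by (intro C(2)[rule_format]) auto
    finally show "(\<integral>\<^sup>+x. potential x * ennreal (g x) \<partial>lebesgue) \<le> ennreal (C * A powr (1 / t) * B powr (1 / t))"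
      by (simp add: mult_ac)
  qed
qed

section \<open>Absorption of the critical term in the manner of Brezis and Kato\<close>

lemma tail_small:
  assumes "0 < \<epsilon>"
  shows "\<exists>k\<ge>1. (\<integral>\<^sup>+x. ennreal (indicator {x. real k < u x} x * \<bar>u x\<bar> powr P) \<partial>lebesgue) \<le> ennreal \<epsilon>"
proof -
  have [measurable]: "{x. c < u x} \<in> sets lebesgue" for c
    using borel_measurable_less[OF borel_measurable_const u_measurable, of c] by simp
  have "(\<lambda>k. \<integral>\<^sup>+x. ennreal (indicator {x. real k < u x} x * \<bar>u x\<bar> powr P) \<partial>lebesgue)
      \<longlonglongrightarrow> (\<integral>\<^sup>+x. 0 \<partial>(lebesgue :: 'a measure))"
  proof (rule nn_integral_dominated_convergence[where w = "\<lambda>x. ennreal (\<bar>u x\<bar> powr P)"])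
    show "AE x in lebesgue. (\<lambda>k. ennreal (indicator {x. real k < u x} x * \<bar>u x\<bar> powr P)) \<longlonglongrightarrow> 0"
    proof (intro AE_I2 tendsto_eventually)
      fix x
      show "\<forall>\<^sub>F k in sequentially. ennreal (indicator {x. real k < u x} x * \<bar>u x\<bar> powr P) = 0"
        using eventually_ge_at_top[of "nat \<lceil>u x\<rceil>"] by eventually_elim (auto simp: indicator_def)
    qed
  qed (use u_integrable in \<open>auto intro!: ennreal_leI simp: indicator_def\<close>)
  then have "\<forall>\<^sub>F k in sequentially. (\<integral>\<^sup>+x. ennreal (indicator {x. real k < u x} x * \<bar>u x\<bar> powr P) \<partial>lebesgue) < ennreal \<epsilon>"
    using assms by (intro order_tendstoD) auto
  moreover have "\<forall>\<^sub>F k in sequentially. 1 \<le> k" by (rule eventually_ge_at_top)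
  ultimately have "\<forall>\<^sub>F k in sequentially. 1 \<le> k \<and> (\<integral>\<^sup>+x. ennreal (indicator {x. real k < u x} x * \<bar>u x\<bar> powr P) \<partial>lebesgue) < ennreal \<epsilon>"
    by eventually_elim simp
  then show ?thesis by (auto dest!: eventually_happens intro: less_imp_le)
qed

text \<open>The contribution of \<open>{u > k}\<close> is absorbed into the left-hand side, that of \<open>{u \<le> k}\<close> is bounded
  independently of the truncation level \<open>M\<close>; no iteration over exponents is needed.\<close>

lemma all_powers_integrable_aux:
  "(\<integral>\<^sup>+x. ennreal ((max (u x) 0 * max (u x) 0 ^ m) powr P) \<partial>lebesgue) < \<infinity>"
proof -
  obtain S where S: "0 \<le> S" "\<forall>\<phi> L w K D. profile \<phi> L \<longrightarrow> w \<in> borel_measurable borel \<longrightarrow> w 0 = 0 \<longrightarrow> 0 \<le> K \<longrightarrow>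
    (\<forall>x y. (w x - w y)\<^sup>2 \<le> K * ((x - y) * (\<phi> x - \<phi> y))) \<longrightarrow> 0 \<le> D \<longrightarrow>
    (\<integral>\<^sup>+x. potential x * ennreal (weighted \<phi> x) \<partial>lebesgue) \<le> ennreal D \<longrightarrow>
    (\<integral>\<^sup>+x. ennreal (\<bar>w (u x)\<bar> powr P) \<partial>lebesgue) \<le> ennreal (S * (K * D) powr (P / 2))"
    using energy by auto
  obtain H where H: "0 \<le> H" "\<forall>(g :: 'a \<Rightarrow> real) B. g \<in> borel_measurable lebesgue \<longrightarrow> (\<forall>x. 0 \<le> g x) \<longrightarrow> 0 \<le> B \<longrightarrow>
    (\<integral>\<^sup>+x. ennreal (g x powr t) \<partial>lebesgue) \<le> ennreal B \<longrightarrow>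
    (\<integral>\<^sup>+x. potential x * ennreal (g x) \<partial>lebesgue) \<le> ennreal (H * B powr (1 / t))"
    using potential_pairing by auto
  have [measurable]: "{x. c < u x} \<in> sets lebesgue" for c
    using borel_measurable_less[OF borel_measurable_const u_measurable, of c] by simp
  define K where "K = (1 + real m)\<^sup>2"
  \<comment> \<open>The Hoelder weight of the small factor: the \<open>t\<close>-th power of
    \<open>u^(R - 2) * w^2\<close> is \<open>(u^P)^\<alpha> * (w^P)^(2 / R)\<close>.\<close>
  define \<alpha> where "\<alpha> = (R - 2) / R"
  define S1 where "S1 = S powr (2 / P) * K"
  \<comment> \<open>The tail must be this small for the coefficient of the absorbed term to be at
    most one half; adding 1 to \<open>S1 * H\<close> prevents a zero denominator.\<close>
  define E where "E = (1 / (2 * (S1 * H + 1))) powr (t / \<alpha>)"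
  have \<alpha>: "0 < \<alpha>" "0 < 2 / R" "\<alpha> + 2 / R = 1" "P * \<alpha> = (R - 2) * t" "P * (2 / R) = 2 * t"
    "2 / R * (1 / t) = 2 / P"
    using exponents by (auto simp: \<alpha>_def field_simps)
  have S1: "0 \<le> S1" "0 \<le> K" by (auto simp: S1_def K_def)
  have S1H: "0 \<le> S1 * H" using S1 H by simp
  have E: "E > 0" using S1H by (simp add: E_def)
  have half: "S1 * (H * E powr (\<alpha> * (1 / t))) \<le> 1 / 2"
  proof -
    have "E powr (\<alpha> * (1 / t)) = 1 / (2 * (S1 * H + 1))"
    proof -
      have "t / \<alpha> * (\<alpha> * (1 / t)) = 1" using \<alpha>(1) exponents(4) by simp
      then show ?thesis using S1H by (simp only: E_def powr_powr) simp
    qed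
    moreover have "z * (1 / (2 * (z + 1))) \<le> 1 / 2" if "0 \<le> z" for z :: real
      using that by (simp add: field_simps)
    ultimately show ?thesis using S1H by (simp only: mult.assoc[symmetric])
  qed
  obtain k0 :: nat where k0: "k0 \<ge> 1" "(\<integral>\<^sup>+x. ennreal (indicator {x. real k0 < u x} x * \<bar>u x\<bar> powr P) \<partial>lebesgue) \<le> ennreal E"
    using tail_small[OF E] by auto
  define k where "k = real k0"
  have k: "1 \<le> k" "(\<integral>\<^sup>+x. ennreal (indicator {x. k < u x} x * \<bar>u x\<bar> powr P) \<partial>lebesgue) \<le> ennreal E"
    using k0 by (auto simp: k_def)
  define b where "b = k powr (R - 1) * (k * (k ^ m)\<^sup>2)"
  have b: "0 \<le> b" using k by (simp add: b_def)
  define B1 where "B1 = b powr t * measure lebesgue \<Omega>"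
  have B1: "0 \<le> B1" by (simp add: B1_def)
  define c where "c = (2 * S1 * (H * B1 powr (1 / t))) powr (P / 2)"
  have uniform: "(\<integral>\<^sup>+x. ennreal ((max (u x) 0 * min (max (u x) 0) M ^ m) powr P) \<partial>lebesgue) \<le> ennreal c"
    if M: "0 \<le> M" for M
  proof -
    define h where "h = (\<lambda>\<tau>. min (max \<tau> 0) M ^ m)"
    define \<phi> where "\<phi> = (\<lambda>\<tau>. max \<tau> 0 * (h \<tau>)\<^sup>2)"
    define w where "w = (\<lambda>\<tau>. max \<tau> 0 * h \<tau>)"
    have trunc: "mono \<phi>" "\<bar>\<phi> x - \<phi> y\<bar> \<le> (1 + 2 * real m) * M ^ (2 * m) * \<bar>x - y\<bar>"
      "(w x - w y)\<^sup>2 \<le> (1 + real m)\<^sup>2 * ((x - y) * (\<phi> x - \<phi> y))" for x y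
      unfolding \<phi>_def w_def h_def by (rule truncated_power[OF M])+
    have profile: "profile \<phi> ((1 + 2 * real m) * M ^ (2 * m))"
      using trunc(1,2) by (simp add: profile_def) (simp add: \<phi>_def)
    have [measurable]: "\<phi> \<in> borel_measurable borel" using profile by (rule profileD)
    have [measurable]: "w \<in> borel_measurable borel" unfolding w_def h_def by measurable
    have w0: "0 \<le> w \<tau>" "0 \<le> h \<tau>" for \<tau> using M by (auto simp: w_def h_def)
    have "(\<integral>\<^sup>+x. ennreal (w (u x) powr P) \<partial>lebesgue) \<le> (\<integral>\<^sup>+x. ennreal ((M ^ m) powr P) * ennreal (\<bar>u x\<bar> powr P) \<partial>lebesgue)"
    proof (rule nn_integral_mono)
      fix x
      have "w (u x) \<le> \<bar>u x\<bar> * M ^ m"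
        unfolding w_def h_def using M by (intro mult_mono power_mono) auto
      then have "w (u x) powr P \<le> (\<bar>u x\<bar> * M ^ m) powr P"
        using w0 exponents by (intro powr_mono2) auto
      then show "ennreal (w (u x) powr P) \<le> ennreal ((M ^ m) powr P) * ennreal (\<bar>u x\<bar> powr P)"
        by (simp add: powr_mult mult.commute ennreal_leI flip: ennreal_mult)
    qed
    also have "\<dots> < \<infinity>" using u_integrable by (simp add: nn_integral_cmult ennreal_mult_less_top)
    \<comment> \<open>Absorbing \<open>W\<close> is legitimate only if it is finite. The cap at
      \<open>M\<close> ensures this, as \<open>w (u x)\<close> is at most \<open>M ^ m\<close> times
      \<open>\<bar>u x\<bar>\<close>; the bound for \<open>W\<close> obtained below no longer
      depends on \<open>M\<close>.\<close>
    finally obtain W where W: "0 \<le> W" "(\<integral>\<^sup>+x. ennreal (w (u x) powr P) \<partial>lebesgue) = ennreal W"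
      by (cases "\<integral>\<^sup>+x. ennreal (w (u x) powr P) \<partial>lebesgue") auto
    \<comment> \<open>On \<open>{u \<le> k}\<close> the weight is at most \<open>b\<close>, whatever
      \<open>M\<close> is. On \<open>{u > k}\<close>, where \<open>u\<close> exceeds 1, it equals
      \<open>u^(R - 2) * w^2\<close>, which exposes the factor with small norm.\<close>
    define g1 where "g1 = (\<lambda>x. indicator \<Omega> x * b)"
    define g2 where "g2 = (\<lambda>x. indicator {x. k < u x} x * (\<bar>u x\<bar> powr (R - 2) * w (u x) powr 2))"
    have [measurable]: "g1 \<in> borel_measurable lebesgue" "g2 \<in> borel_measurable lebesgue"
      unfolding g1_def g2_def by measurable
    have g0: "0 \<le> g1 x" "0 \<le> g2 x" for x using b by (auto simp: g1_def g2_def)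
    have split: "weighted \<phi> x \<le> g1 x + g2 x" for x
    proof (cases "x \<in> \<Omega>")
      case True
      show ?thesis
      proof (cases "k < u x")
        case False
        have "max 1 (u x) powr (R - 1) * \<phi> (u x) \<le> b"
          unfolding b_def \<phi>_def h_def using False k M exponents
          by (intro mult_mono powr_mono2 power_mono) auto
        then show ?thesis using True False by (simp add: weighted_def g1_def g2_def)
      next
        case ux: True
        have "max 1 (u x) powr (R - 1) * \<phi> (u x) = (u x powr (R - 2) * u x powr 1) * (u x * (h (u x))\<^sup>2)"
          using ux k powr_add[of "u x" "R - 2" 1] by (simp add: \<phi>_def)
        also have "\<dots> = \<bar>u x\<bar> powr (R - 2) * w (u x) powr 2"
          using ux k w0 by (simp add: w_def power2_eq_square)
        finally show ?thesis using True ux b by (simp add: weighted_def g1_def g2_def)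
      qed
    qed (use g0 in \<open>auto simp: weighted_def intro: add_nonneg_nonneg\<close>)
    have "(\<integral>\<^sup>+x. ennreal (g1 x powr t) \<partial>lebesgue) = (\<integral>\<^sup>+x. ennreal (b powr t) * indicator \<Omega> x \<partial>lebesgue)"
      by (intro nn_integral_cong) (simp add: g1_def indicator_def)
    also have "\<dots> = ennreal B1"
      using \<Omega>_lmeasurable by (simp add: nn_integral_cmult B1_def emeasure_eq_measure2 ennreal_mult)
    finally have I1: "(\<integral>\<^sup>+x. potential x * ennreal (g1 x) \<partial>lebesgue) \<le> ennreal (H * B1 powr (1 / t))"
      using g0 B1 by (intro H(2)[rule_format]) auto
    have "(\<integral>\<^sup>+x. ennreal (g2 x powr t) \<partial>lebesgue)
        = (\<integral>\<^sup>+x. ennreal ((indicator {x. k < u x} x * \<bar>u x\<bar> powr P) powr \<alpha> * (w (u x) powr P) powr (2 / R)) \<partial>lebesgue)"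
    proof (intro nn_integral_cong arg_cong[where f = ennreal])
      fix x
      have "(\<bar>u x\<bar> powr (R - 2) * w (u x) powr 2) powr t = (\<bar>u x\<bar> powr P) powr \<alpha> * (w (u x) powr P) powr (2 / R)"
        by (simp only: powr_mult powr_powr \<alpha>)
      then show "g2 x powr t = (indicator {x. k < u x} x * \<bar>u x\<bar> powr P) powr \<alpha> * (w (u x) powr P) powr (2 / R)"
        by (simp add: g2_def indicator_def)
    qed
    also have "\<dots> \<le> ennreal (E powr \<alpha> * W powr (2 / R))"
      using k W E \<alpha> by (intro nn_integral_Holder) auto
    finally have "(\<integral>\<^sup>+x. potential x * ennreal (g2 x) \<partial>lebesgue) \<le> ennreal (H * (E powr \<alpha> * W powr (2 / R)) powr (1 / t))"
      using g0 by (intro H(2)[rule_format]) auto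
    also have "(E powr \<alpha> * W powr (2 / R)) powr (1 / t) = E powr (\<alpha> * (1 / t)) * W powr (2 / P)"
      by (simp only: powr_mult powr_powr \<alpha>)
    finally have I2: "(\<integral>\<^sup>+x. potential x * ennreal (g2 x) \<partial>lebesgue) \<le> ennreal (H * (E powr (\<alpha> * (1 / t)) * W powr (2 / P)))" .
    define D where "D = H * B1 powr (1 / t) + H * (E powr (\<alpha> * (1 / t)) * W powr (2 / P))"
    have D: "0 \<le> D" using H by (simp add: D_def)
    have "(\<integral>\<^sup>+x. potential x * ennreal (weighted \<phi> x) \<partial>lebesgue)
        \<le> (\<integral>\<^sup>+x. potential x * ennreal (g1 x) + potential x * ennreal (g2 x) \<partial>lebesgue)"
      using g0 split
      by (intro nn_integral_mono) (simp add: mult_left_mono ennreal_leI flip: distrib_left ennreal_plus)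
    also have "\<dots> = (\<integral>\<^sup>+x. potential x * ennreal (g1 x) \<partial>lebesgue) + (\<integral>\<^sup>+x. potential x * ennreal (g2 x) \<partial>lebesgue)"
      by (intro nn_integral_add) measurable
    also have "\<dots> \<le> ennreal D"
      unfolding D_def using I1 I2 H by (simp add: add_mono)
    finally have J: "(\<integral>\<^sup>+x. potential x * ennreal (weighted \<phi> x) \<partial>lebesgue) \<le> ennreal D" .
    have "(\<integral>\<^sup>+x. ennreal (\<bar>w (u x)\<bar> powr P) \<partial>lebesgue) \<le> ennreal (S * (K * D) powr (P / 2))"
    proof (rule S(2)[rule_format, OF profile])
      show "(w x - w y)\<^sup>2 \<le> K * ((x - y) * (\<phi> x - \<phi> y))" for x y
        using trunc(3) by (simp add: K_def)
      show "w \<in> borel_measurable borel" by measurable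
      show "w 0 = 0" by (simp add: w_def)
    qed (use J D S1 in auto)
    then have "W \<le> S * (K * D) powr (P / 2)"
      using W S by (simp add: w0)
    then have "W powr (2 / P) \<le> (S * (K * D) powr (P / 2)) powr (2 / P)"
      using W exponents by (intro powr_mono2) auto
    also have "\<dots> = S1 * D"
      using S1 D exponents by (simp add: powr_mult powr_powr S1_def)
    also have "\<dots> = S1 * (H * B1 powr (1 / t)) + S1 * (H * E powr (\<alpha> * (1 / t))) * W powr (2 / P)"
      by (simp add: D_def algebra_simps)
    \<comment> \<open>Both sides carry the same power \<open>2 / P\<close> of \<open>W\<close>,
      because \<open>2 / R * (1 / t) = 2 / P\<close>; the right-hand one is absorbed thanks to its
      coefficient.\<close>
    also have "\<dots> \<le> S1 * (H * B1 powr (1 / t)) + 1 / 2 * W powr (2 / P)"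
      using half by (intro add_left_mono mult_right_mono) auto
    finally have "W powr (2 / P) \<le> 2 * S1 * (H * B1 powr (1 / t))" by simp
    then have "(W powr (2 / P)) powr (P / 2) \<le> c"
      unfolding c_def using exponents by (intro powr_mono2) auto
    then have "W \<le> c" using W exponents by (simp add: powr_powr)
    then show ?thesis using W by (simp add: w_def h_def ennreal_leI)
  qed
  have "(\<lambda>i::nat. \<integral>\<^sup>+x. ennreal ((max (u x) 0 * min (max (u x) 0) (real i) ^ m) powr P) \<partial>lebesgue)
      \<longlonglongrightarrow> (\<integral>\<^sup>+x. ennreal ((max (u x) 0 * max (u x) 0 ^ m) powr P) \<partial>lebesgue)"
  proof (rule nn_integral_LIMSEQ)
    show "incseq (\<lambda>i x. ennreal ((max (u x) 0 * min (max (u x) 0) (real i) ^ m) powr P))"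
      using exponents by (auto simp: incseq_def le_fun_def intro!: ennreal_leI powr_mono2 mult_left_mono power_mono)
    fix x
    have "\<forall>\<^sub>F i in sequentially. min (max (u x) 0) (real i) = max (u x) 0"
      using eventually_ge_at_top[of "nat \<lceil>max (u x) 0\<rceil>"] by eventually_elim (auto simp: min_def)
    then show "(\<lambda>i. ennreal ((max (u x) 0 * min (max (u x) 0) (real i) ^ m) powr P))
        \<longlonglongrightarrow> ennreal ((max (u x) 0 * max (u x) 0 ^ m) powr P)"
      by (intro tendsto_eventually) (auto elim: eventually_mono)
  qed measurable
  then have "(\<integral>\<^sup>+x. ennreal ((max (u x) 0 * max (u x) 0 ^ m) powr P) \<partial>lebesgue) \<le> ennreal c"
    using uniform by (intro LIMSEQ_le_const2) auto
  then show ?thesis by (rule le_less_trans) simp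
qed

lemma all_powers_integrable:
  "(\<integral>\<^sup>+x. ennreal (indicator \<Omega> x * max 1 (u x) powr e) \<partial>lebesgue) < \<infinity>"
proof -
  obtain m :: nat where m: "e / P \<le> real m" using real_arch_simple by blast
  have "e \<le> real m * P" using m exponents by (simp add: field_simps)
  also have "\<dots> \<le> real (Suc m) * P" using exponents by (intro mult_right_mono) auto
  finally have e: "e \<le> real (Suc m) * P" .
  have "(\<integral>\<^sup>+x. ennreal (indicator \<Omega> x * max 1 (u x) powr e) \<partial>lebesgue)
      \<le> (\<integral>\<^sup>+x. indicator \<Omega> x + ennreal ((max (u x) 0 * max (u x) 0 ^ m) powr P) \<partial>lebesgue)"
  proof (rule nn_integral_mono)
    fix x
    show "ennreal (indicator \<Omega> x * max 1 (u x) powr e) \<le> indicator \<Omega> x + ennreal ((max (u x) 0 * max (u x) 0 ^ m) powr P)"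
    proof (cases "x \<in> \<Omega>")
      case True
      show ?thesis
      proof (cases "u x \<le> 1")
        case False
        have "u x powr e \<le> u x powr (real (Suc m) * P)" using False e by (intro powr_mono) auto
        also have "\<dots> = (u x ^ Suc m) powr P"
          using False by (simp only: powr_powr[symmetric] powr_realpow)
        finally show ?thesis using False True by (auto intro!: ennreal_leI add_increasing)
      qed (use True in \<open>simp add: max_def\<close>)
    qed simp
  qed
  also have "\<dots> = emeasure lebesgue \<Omega> + (\<integral>\<^sup>+x. ennreal ((max (u x) 0 * max (u x) 0 ^ m) powr P) \<partial>lebesgue)"
    by (subst nn_integral_add) auto
  also have "\<dots> < \<infinity>"
    using all_powers_integrable_aux[of m] fmeasurableD2[OF \<Omega>_lmeasurable] by (simp add: less_top)
  finally show ?thesis .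
qed

end

section \<open>Boundedness\<close>

context nonneg_choquard_solution begin

text \<open>Young's inequality separates the source from the kernel. Slightly raising the kernel to
  the power \<open>b\<close> keeps it integrable near \<open>x\<close>, at the price of the possibly
  large conjugate power \<open>e\<close> of the source, now available.\<close>

lemma potential_bounded: "\<exists>B\<ge>0. \<forall>x\<in>\<Omega>. potential x \<le> ennreal B"
proof -
  \<comment> \<open>With this choice \<open>\<mu> * b\<close> is the midpoint of \<mu> and
    \<open>n\<close>.\<close>
  define b where "b = (n + \<mu>) / (2 * \<mu>)"
  define e where "e = b / (b - 1)"
  have b: "1 < b" "\<mu> * b < n" using \<mu> by (auto simp: b_def field_simps)
  have e: "1 < e" "1 / e + 1 / b = 1" using b by (auto simp: e_def field_simps)
  obtain C where C: "0 \<le> C" "\<forall>(x::'a) \<rho>. \<rho> > 0 \<longrightarrow>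
      (\<integral>\<^sup>+y. ennreal (norm (x - y) powr - (\<mu> * b)) * indicator (ball x \<rho>) y \<partial>lebesgue)
        \<le> ennreal (C * \<rho> powr (n - \<mu> * b))"
    using nn_integral_kernel_ball[where 'a = 'a, of "\<mu> * b"] b \<mu> unfolding n by auto
  obtain d where d: "d > 0" "\<And>x. x \<in> \<Omega> \<Longrightarrow> norm x < d"
    using \<Omega>(2) by (metis bounded_pos_less)
  have "(\<integral>\<^sup>+y. ennreal (indicator \<Omega> y * max 1 (u y) powr (R * e)) \<partial>lebesgue) < \<infinity>"
    by (rule all_powers_integrable)
  then obtain Q where Q: "0 \<le> Q" "(\<integral>\<^sup>+y. ennreal (indicator \<Omega> y * max 1 (u y) powr (R * e)) \<partial>lebesgue) = ennreal Q"
    by (cases "\<integral>\<^sup>+y. ennreal (indicator \<Omega> y * max 1 (u y) powr (R * e)) \<partial>lebesgue") auto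
  define B where "B = 2 powr e * Q + C * (2 * d) powr (n - \<mu> * b)"
  have "potential x \<le> ennreal B" if x: "x \<in> \<Omega>" for x
  proof -
    have "potential x \<le> (\<integral>\<^sup>+y. ennreal (2 powr e) * ennreal (indicator \<Omega> y * max 1 (u y) powr (R * e))
        + ennreal (norm (x - y) powr - (\<mu> * b)) * indicator (ball x (2 * d)) y \<partial>lebesgue)"
      unfolding potential_def
    proof (rule nn_integral_mono_AE)
      show "AE y in lebesgue. ennreal (source y * norm (x - y) powr - \<mu>)
          \<le> ennreal (2 powr e) * ennreal (indicator \<Omega> y * max 1 (u y) powr (R * e))
          + ennreal (norm (x - y) powr - (\<mu> * b)) * indicator (ball x (2 * d)) y"
        using nonneg
      proof eventually_elim
        case (elim y)
        show ?case
        proof (cases "y \<in> \<Omega>")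
          case True
          let ?G = "max 1 (u y) powr R"
          have "u y powr R \<le> ?G" using elim exponents by (intro powr_mono2) auto
          moreover have "1 \<le> ?G" using exponents by (intro ge_one_powr_ge_zero) auto
          ultimately have "source y \<le> 2 * ?G" using True elim by (simp add: source_def)
          then have "source y * norm (x - y) powr - \<mu> \<le> (2 * ?G) * norm (x - y) powr - \<mu>"
            by (intro mult_right_mono) auto
          also have "\<dots> \<le> (2 * ?G) powr e / e + (norm (x - y) powr - \<mu>) powr b / b"
            using e b by (intro Youngs_inequality) auto
          also have "\<dots> \<le> (2 * ?G) powr e + (norm (x - y) powr - \<mu>) powr b"
            using e b by (intro add_mono) (auto simp: divide_le_eq_1 mult_le_cancel_left1 divide_le_eq)
          also have "\<dots> = 2 powr e * max 1 (u y) powr (R * e) + norm (x - y) powr - (\<mu> * b)"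
            by (simp add: powr_mult powr_powr)
          finally have "ennreal (source y * norm (x - y) powr - \<mu>)
              \<le> ennreal (2 powr e * max 1 (u y) powr (R * e) + norm (x - y) powr - (\<mu> * b))"
            by (rule ennreal_leI)
          moreover have "y \<in> ball x (2 * d)"
            using norm_triangle_ineq4[of x y] d(2)[OF x] d(2)[OF True] by (simp add: dist_norm)
          ultimately show ?thesis using True by (simp add: ennreal_mult)
        qed (simp add: source_def)
      qed
    qed
    also have "\<dots> = ennreal (2 powr e) * (\<integral>\<^sup>+y. ennreal (indicator \<Omega> y * max 1 (u y) powr (R * e)) \<partial>lebesgue)
        + (\<integral>\<^sup>+y. ennreal (norm (x - y) powr - (\<mu> * b)) * indicator (ball x (2 * d)) y \<partial>lebesgue)"
      by (simp add: nn_integral_add nn_integral_cmult)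
    also have "\<dots> \<le> ennreal (2 powr e) * ennreal Q + ennreal (C * (2 * d) powr (n - \<mu> * b))"
      using C(2) d(1) by (intro add_mono) (auto simp: Q)
    also have "\<dots> = ennreal B" using Q C by (simp add: B_def ennreal_mult)
    finally show ?thesis .
  qed
  moreover have "0 \<le> B" using Q C by (simp add: B_def)
  ultimately show ?thesis by blast
qed

section \<open>Decay of the superlevel sets\<close>

lemma superlevel_sets [measurable]: "{x \<in> \<Omega>. k < u x} \<in> sets lebesgue"
proof -
  have "{x. k < u x} \<in> sets lebesgue"
    using borel_measurable_less[OF borel_measurable_const u_measurable, of k] by simp
  then have "\<Omega> \<inter> {x. k < u x} \<in> sets lebesgue" by (rule sets.Int[OF \<Omega>_sets])
  then show ?thesis by (simp add: Int_def)
qed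

lemma superlevel_lmeasurable: "{x \<in> \<Omega>. k < u x} \<in> lmeasurable"
  by (rule fmeasurableI2[OF \<Omega>_lmeasurable]) (auto intro: superlevel_sets)

text \<open>For \<open>W\<close>, the integral of the \<open>P\<close>-th power of the truncated
  excess over \<open>k\<close>, testing with that excess gives
  \<open>W \<le> c * W^(1/2) * |A|^(1/P')\<close>. Cancelling the root gives the exponent
  \<open>2 / P' = 1 + (1 - 2 / P)\<close>, above 1 since \<open>P > 2\<close>; Chebyshev at the
  level \<open>h\<close> concludes.\<close>

lemma superlevel_decay:
  "\<exists>C. \<forall>k h. 0 \<le> k \<longrightarrow> k < h \<longrightarrow> measure lebesgue {x \<in> \<Omega>. h < u x}
    \<le> C * (h - k) powr - P * measure lebesgue {x \<in> \<Omega>. k < u x} powr (1 + (1 - 2 / P))"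
proof -
  obtain S where S: "0 \<le> S" "\<forall>\<phi> L w K D. profile \<phi> L \<longrightarrow> w \<in> borel_measurable borel \<longrightarrow> w 0 = 0 \<longrightarrow> 0 \<le> K \<longrightarrow>
    (\<forall>x y. (w x - w y)\<^sup>2 \<le> K * ((x - y) * (\<phi> x - \<phi> y))) \<longrightarrow> 0 \<le> D \<longrightarrow>
    (\<integral>\<^sup>+x. potential x * ennreal (weighted \<phi> x) \<partial>lebesgue) \<le> ennreal D \<longrightarrow>
    (\<integral>\<^sup>+x. ennreal (\<bar>w (u x)\<bar> powr P) \<partial>lebesgue) \<le> ennreal (S * (K * D) powr (P / 2))"
    using energy by auto
  obtain B where B: "0 \<le> B" "\<forall>x\<in>\<Omega>. potential x \<le> ennreal B" using potential_bounded by auto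
  define P' where "P' = P / (P - 1)"
  \<comment> \<open>The integral of \<open>G\<close> is split by Hoelder with weight
    \<open>2 / P\<close> on the set \<open>A\<close>. After the Sobolev power \<open>P / 2\<close>
    this leaves exactly \<open>|A|^(1/P')\<close>, and the other weight \<open>1 - 2 / P\<close>
    requires integrability of \<open>u\<close> to this power \<open>e\<close>.\<close>
  define e where "e = (R - 1) * P' / (1 - 2 / P)"
  have P': "0 < 1 / P" "0 < 1 / P'" "1 / P + 1 / P' = 1" "1 / P' = 1 - 1 / P" "0 < P'"
    using exponents(2) by (auto simp: P'_def field_simps)
  have \<theta>: "0 < 2 / P" "0 < 1 - 2 / P" "e * (1 - 2 / P) = (R - 1) * P'"
    using exponents(2) by (auto simp: e_def)
  have "(\<integral>\<^sup>+x. ennreal (indicator \<Omega> x * max 1 (u x) powr e) \<partial>lebesgue) < \<infinity>"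
    by (rule all_powers_integrable)
  then obtain Q where Q: "0 \<le> Q" "(\<integral>\<^sup>+x. ennreal (indicator \<Omega> x * max 1 (u x) powr e) \<partial>lebesgue) = ennreal Q"
    by (cases "\<integral>\<^sup>+x. ennreal (indicator \<Omega> x * max 1 (u x) powr e) \<partial>lebesgue") auto
  define c where "c = S * (B * Q powr ((1 - 2 / P) * (1 / P'))) powr (P / 2)"
  have c: "0 \<le> c" using S by (simp add: c_def)
  show ?thesis
  proof (intro exI[of _ "c\<^sup>2"] allI impI)
    fix k h :: real
    assume k: "0 \<le> k" and h: "k < h"
    define A where "A = {x \<in> \<Omega>. k < u x}"
    have A_sets [measurable]: "A \<in> sets lebesgue" unfolding A_def by (rule superlevel_sets)
    have emA: "emeasure lebesgue A = ennreal (measure lebesgue A)"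
      unfolding A_def by (rule emeasure_eq_measure2[OF superlevel_lmeasurable])
    have int_A: "(\<integral>\<^sup>+x. ennreal (indicator A x) \<partial>lebesgue) \<le> ennreal (measure lebesgue A)"
      by (simp only: ennreal_indicator nn_integral_indicator[OF A_sets] emA order_refl)
    define \<phi> where "\<phi> = (\<lambda>\<tau>. max (\<tau> - k) 0)"
    have profile: "profile \<phi> 1" and sq: "(\<phi> x - \<phi> y)\<^sup>2 \<le> 1 * ((x - y) * (\<phi> x - \<phi> y))" for x y
      unfolding \<phi>_def using k by (rule profile_shifted_positive_part)+
    have [measurable]: "\<phi> \<in> borel_measurable borel" using profile by (rule profileD)
    have \<phi>0: "0 \<le> \<phi> \<tau>" for \<tau> by (simp add: \<phi>_def)
    have "(\<integral>\<^sup>+x. ennreal (\<phi> (u x) powr P) \<partial>lebesgue) \<le> (\<integral>\<^sup>+x. ennreal (\<bar>u x\<bar> powr P) \<partial>lebesgue)"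
      using k exponents(2) by (intro nn_integral_mono ennreal_leI powr_mono2) (auto simp: \<phi>_def)
    also have "\<dots> < \<infinity>" by (rule u_integrable)
    finally obtain W where W: "0 \<le> W" "(\<integral>\<^sup>+x. ennreal (\<phi> (u x) powr P) \<partial>lebesgue) = ennreal W"
      by (cases "\<integral>\<^sup>+x. ennreal (\<phi> (u x) powr P) \<partial>lebesgue") auto
    define G where "G = (\<lambda>x. indicator A x * max 1 (u x) powr ((R - 1) * P'))"
    have [measurable]: "G \<in> borel_measurable lebesgue" unfolding G_def by measurable
    define q where "q = measure lebesgue A powr (2 / P) * Q powr (1 - 2 / P)"
    have "(\<integral>\<^sup>+x. ennreal (G x) \<partial>lebesgue)
        \<le> (\<integral>\<^sup>+x. ennreal (indicator A x powr (2 / P) * (indicator \<Omega> x * max 1 (u x) powr e) powr (1 - 2 / P)) \<partial>lebesgue)"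
    proof (intro nn_integral_mono ennreal_leI)
      fix x
      have "(max 1 (u x) powr e) powr (1 - 2 / P) = max 1 (u x) powr ((R - 1) * P')"
        by (simp only: powr_powr \<theta>(3))
      then show "G x \<le> indicator A x powr (2 / P) * (indicator \<Omega> x * max 1 (u x) powr e) powr (1 - 2 / P)"
        by (cases "x \<in> A") (simp_all add: G_def, simp add: A_def)
    qed
    also have "\<dots> \<le> ennreal q"
      unfolding q_def using \<theta> Q int_A by (intro nn_integral_Holder) auto
    finally have G: "(\<integral>\<^sup>+x. ennreal (G x) \<partial>lebesgue) \<le> ennreal q" .
    have "(\<integral>\<^sup>+x. ennreal (weighted \<phi> x) \<partial>lebesgue)
        = (\<integral>\<^sup>+x. ennreal ((\<phi> (u x) powr P) powr (1 / P) * G x powr (1 / P')) \<partial>lebesgue)"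
    proof (intro nn_integral_cong arg_cong[where f = ennreal])
      fix x
      have "(max 1 (u x) powr ((R - 1) * P')) powr (1 / P') = max 1 (u x) powr (R - 1)"
      proof -
        have "(R - 1) * P' * (1 / P') = R - 1" using P'(5) by simp
        then show ?thesis by (simp only: powr_powr)
      qed
      moreover have "(\<phi> (u x) powr P) powr (1 / P) = \<phi> (u x)"
        using exponents(2) \<phi>0 by (simp add: powr_powr)
      moreover have "x \<in> \<Omega> \<Longrightarrow> x \<notin> A \<Longrightarrow> \<phi> (u x) = 0" by (auto simp: A_def \<phi>_def)
      ultimately show "weighted \<phi> x = (\<phi> (u x) powr P) powr (1 / P) * G x powr (1 / P')"
        by (cases "x \<in> A") (auto simp: weighted_def G_def A_def indicator_def)
    qed
    also have "\<dots> \<le> ennreal (W powr (1 / P) * q powr (1 / P'))"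
      using W G P' by (intro nn_integral_Holder) (auto simp: G_def q_def)
    finally have wt: "(\<integral>\<^sup>+x. ennreal (weighted \<phi> x) \<partial>lebesgue) \<le> ennreal (W powr (1 / P) * q powr (1 / P'))" .
    define D where "D = B * (W powr (1 / P) * q powr (1 / P'))"
    have [measurable]: "weighted \<phi> \<in> borel_measurable lebesgue" unfolding weighted_def by measurable
    have "(\<integral>\<^sup>+x. potential x * ennreal (weighted \<phi> x) \<partial>lebesgue) \<le> (\<integral>\<^sup>+x. ennreal B * ennreal (weighted \<phi> x) \<partial>lebesgue)"
    proof (rule nn_integral_mono)
      fix x
      show "potential x * ennreal (weighted \<phi> x) \<le> ennreal B * ennreal (weighted \<phi> x)"
        using B by (cases "x \<in> \<Omega>") (auto simp: weighted_def intro: mult_right_mono)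
    qed
    also have "\<dots> = ennreal B * (\<integral>\<^sup>+x. ennreal (weighted \<phi> x) \<partial>lebesgue)"
      by (simp add: nn_integral_cmult)
    also have "\<dots> \<le> ennreal B * ennreal (W powr (1 / P) * q powr (1 / P'))"
      by (intro mult_left_mono wt) simp
    finally have J: "(\<integral>\<^sup>+x. potential x * ennreal (weighted \<phi> x) \<partial>lebesgue) \<le> ennreal D"
      using B by (simp add: D_def ennreal_mult)
    have D0: "0 \<le> D" using B by (simp add: D_def)
    have "(\<integral>\<^sup>+x. ennreal (\<bar>\<phi> (u x)\<bar> powr P) \<partial>lebesgue) \<le> ennreal (S * (1 * D) powr (P / 2))"
      using profile sq J D0 k by (intro S(2)[rule_format, of \<phi>]) (auto simp: \<phi>_def)
    then have "W \<le> S * D powr (P / 2)" using W S \<phi>0 by simp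
    also have "\<dots> = c * (W powr (1 / 2) * measure lebesgue A powr (1 / P'))"
    proof -
      have "(W powr (1 / P)) powr (P / 2) = W powr (1 / 2)"
        using exponents(2) by (simp add: powr_powr)
      moreover have "((measure lebesgue A powr (2 / P)) powr (1 / P')) powr (P / 2) = measure lebesgue A powr (1 / P')"
        using exponents(2) by (simp add: powr_powr)
      ultimately show ?thesis
        by (simp only: D_def q_def c_def powr_mult mult_ac powr_powr)
    qed
    finally have W1: "W \<le> c * (W powr (1 / 2) * measure lebesgue A powr (1 / P'))" .
    \<comment> \<open>Cancelling the square root needs \<open>W\<close> positive and finite;
      finiteness was secured above from \<open>u_integrable\<close>.\<close>
    have W2: "W \<le> c\<^sup>2 * measure lebesgue A powr (1 + (1 - 2 / P))"
    proof (cases "W = 0")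
      case False
      then have "0 < W" using W by simp
      have sW: "W powr (1 / 2) * W powr (1 / 2) = W" using \<open>0 < W\<close> by (simp flip: powr_add)
      then have "W powr (1 / 2) * W powr (1 / 2) \<le> W powr (1 / 2) * (c * measure lebesgue A powr (1 / P'))"
        using W1 by (simp add: mult_ac)
      then have "W powr (1 / 2) \<le> c * measure lebesgue A powr (1 / P')"
        using \<open>0 < W\<close> by (simp add: mult_le_cancel_left_pos)
      then have "W powr (1 / 2) * W powr (1 / 2) \<le> (c * measure lebesgue A powr (1 / P')) * (c * measure lebesgue A powr (1 / P'))"
        using c by (intro mult_mono) auto
      also have "\<dots> = c\<^sup>2 * (measure lebesgue A powr (1 / P') * measure lebesgue A powr (1 / P'))"
        by (simp add: power2_eq_square mult_ac)
      also have "measure lebesgue A powr (1 / P') * measure lebesgue A powr (1 / P') = measure lebesgue A powr (1 + (1 - 2 / P))"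
        unfolding P'(4) by (simp flip: powr_add)
      finally show ?thesis by (simp only: sW)
    qed simp
    define A' where "A' = {x \<in> \<Omega>. h < u x}"
    have [measurable]: "A' \<in> sets lebesgue" unfolding A'_def by (rule superlevel_sets)
    have "ennreal ((h - k) powr P * measure lebesgue A') = ennreal ((h - k) powr P) * emeasure lebesgue A'"
      unfolding A'_def by (simp add: emeasure_eq_measure2[OF superlevel_lmeasurable] ennreal_mult)
    also have "\<dots> = (\<integral>\<^sup>+x. ennreal ((h - k) powr P) * indicator A' x \<partial>lebesgue)"
      by (simp add: nn_integral_cmult)
    also have "\<dots> \<le> (\<integral>\<^sup>+x. ennreal (\<phi> (u x) powr P) \<partial>lebesgue)"
      using h exponents(2)
      by (intro nn_integral_mono) (auto simp: indicator_def A'_def \<phi>_def intro!: ennreal_leI powr_mono2)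
    finally have "(h - k) powr P * measure lebesgue A' \<le> W" using W by simp
    then have "(h - k) powr P * measure lebesgue A' \<le> c\<^sup>2 * measure lebesgue A powr (1 + (1 - 2 / P))"
      using W2 by simp
    then have "(h - k) powr - P * ((h - k) powr P * measure lebesgue A')
        \<le> (h - k) powr - P * (c\<^sup>2 * measure lebesgue A powr (1 + (1 - 2 / P)))"
      by (rule mult_left_mono) simp
    then show "measure lebesgue {x \<in> \<Omega>. h < u x}
        \<le> c\<^sup>2 * (h - k) powr - P * measure lebesgue {x \<in> \<Omega>. k < u x} powr (1 + (1 - 2 / P))"
      using h by (simp add: A_def A'_def powr_minus mult_ac flip: mult.assoc)
  qed
qed

lemma bounded_AE: "\<exists>C. AE x in lebesgue. x \<in> \<Omega> \<longrightarrow> \<bar>u x\<bar> \<le> C"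
proof -
  obtain C where C: "\<forall>k h. 0 \<le> k \<longrightarrow> k < h \<longrightarrow> measure lebesgue {x \<in> \<Omega>. h < u x}
    \<le> C * (h - k) powr - P * measure lebesgue {x \<in> \<Omega>. k < u x} powr (1 + (1 - 2 / P))"
    using superlevel_decay by auto
  have "\<exists>h. measure lebesgue {x \<in> \<Omega>. h < u x} = 0"
  proof (rule de_giorgi[where ?k0.0 = 0 and C = C and P = P and \<epsilon> = "1 - 2 / P"])
    show "measure lebesgue {x \<in> \<Omega>. h < u x}
      \<le> C * (h - k) powr - P * measure lebesgue {x \<in> \<Omega>. k < u x} powr (1 + (1 - 2 / P))"
      if "0 \<le> k" "k < h" for h k
      using C that by blast
    show "measure lebesgue {x \<in> \<Omega>. h < u x} \<le> measure lebesgue {x \<in> \<Omega>. k < u x}" if "k \<le> h" for h k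
      by (rule measure_mono_fmeasurable[OF _ superlevel_sets superlevel_lmeasurable]) (use that in auto)
  qed (use exponents(2) in auto)
  then obtain h where h: "measure lebesgue {x \<in> \<Omega>. h < u x} = 0" by blast
  have "emeasure lebesgue {x \<in> \<Omega>. h < u x} = 0"
    by (simp only: emeasure_eq_measure2[OF superlevel_lmeasurable] h ennreal_0)
  then have "{x \<in> \<Omega>. h < u x} \<in> null_sets lebesgue" by (rule null_setsI) (rule superlevel_sets)
  then have "AE x in lebesgue. x \<notin> {x \<in> \<Omega>. h < u x}" by (rule AE_not_in)
  then have "AE x in lebesgue. x \<in> \<Omega> \<longrightarrow> \<bar>u x\<bar> \<le> h"
    using nonneg by eventually_elim auto
  then show ?thesis ..
qed

end

theorem theorem1p1:
  fixes \<Omega> :: "'a::euclidean_space set"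
    and a u :: "'a \<Rightarrow> real"
    and s1 s2 \<mu> p q r d lam \<beta> :: real
  assumes domain: "open \<Omega>" "connected \<Omega>" "\<Omega> \<noteq> {}" "bounded \<Omega>" "C2_boundary \<Omega>"
    and s: "0 < s2" "s2 < s1" "s1 < 1" "real DIM('a) > 2 * s1"
    and mu: "0 < \<mu>" "\<mu> < real DIM('a)"
    and pq: "1 < q" "q < p" "p < 2"
    and r: "1 < r" "r \<le> choquard_exponent (real DIM('a)) s1 \<mu>"
    and params: "0 < lam" "0 < \<beta>"
    and d: "q < d" "d < sobolev_exponent (real DIM('a)) s1"
    and a: "a \<in> Lp (lebesgue_on \<Omega>) (d / (d - q))"
      "sign_changing (lebesgue_on \<Omega>) a"
      "\<not> (AE x in lebesgue_on \<Omega>. max (a x) 0 = 0)"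
    and mu_small: "\<mu> < 4 * s1"
    and a_bounded: "a \<in> Linf (lebesgue_on \<Omega>)"
    and sol: "is_solution \<Omega> s1 s2 p q r \<mu> a \<beta> lam u"
    and nonneg: "AE x in lebesgue. 0 \<le> u x"
  shows "u \<in> Linf (lebesgue_on \<Omega>)"
proof -
  have \<Omega>_sets: "\<Omega> \<in> sets lebesgue" using domain(1) by (simp add: borel_open)
  obtain C where "AE x in lebesgue_on \<Omega>. \<bar>a x\<bar> \<le> C" using a_bounded by (auto simp: Linf_def)
  then have a0: "AE x in lebesgue. x \<in> \<Omega> \<longrightarrow> \<bar>a x\<bar> \<le> max 0 C"
    using \<Omega>_sets by (auto simp: AE_restrict_space_iff elim: eventually_mono)
  interpret nonneg_choquard_solution \<Omega> u a s1 s2 p q r \<mu> \<beta> lam "max 0 C" "real DIM('a)"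
    "2 * real DIM('a) / (real DIM('a) - 2 * s1)" "(2 * real DIM('a) - \<mu>) / (real DIM('a) - 2 * s1)"
    "2 * real DIM('a) / (2 * real DIM('a) - \<mu>)"
    using assms a0 by unfold_locales (auto simp: choquard_exponent_def)
  obtain B where "AE x in lebesgue. x \<in> \<Omega> \<longrightarrow> \<bar>u x\<bar> \<le> B" using bounded_AE by auto
  then have "AE x in lebesgue_on \<Omega>. \<bar>u x\<bar> \<le> B"
    using \<Omega>_sets by (simp add: AE_restrict_space_iff)
  moreover have "u \<in> borel_measurable (lebesgue_on \<Omega>)"
    by (rule measurable_restrict_space1[OF u_measurable])
  ultimately show ?thesis by (auto simp: Linf_def)
qed

end
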